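(* Let $Y\subset\mathbb{P}^n$ be a finite set of codimension two linear subspaces with $|Y|\ge2$, let $E=(e_P)_{P\in Y}$ be a sequence of positive integers, and let $Q\in\mathbb{P}^n$ be a general point. Let $I(Y,E)=\bigcap_{P\in Y}(\ell_P,I_P^{e_P})$ be the residual-like ideal determined by $Y$ and $E$ with respect to $Q$. Denote by $\mathcal{L}$ the (possibly empty) set of hyperplanes of $\mathbb{P}^n$ that are spanned by two distinct subspaces of $Y$. Set $$d-1=\max\Big\{\sum_{P\in Y\cap H}e_P \;\Big|\; H\in\mathcal{L}\Big\},$$ where $Y\cap H$ denotes the subset of elements of $Y$ that are contained in $H$, and $d=1$ if $\mathcal{L}=\emptyset$. Then the following two conditions are equivalent: (i) The ideal $I(Y,E)$ is the general residual of a hyperplane arrangement with respect to the linear form $Q^\vee$. (ii) The set $\mathcal{K}=\{H\in\mathcal{L}\mid\sum_{P\in Y\cap H}e_P=d-1\}$ has cardinality $d$ and, for each $P\in Y$, there are exactly $e_P+1$ hyperplanes in $\mathcal{K}$ that contain $P$. In this case, $I(Y,E)$ is the general residual of the hyperplane arrangement determined by $\mathcal{K}$, and $Y=S(\mathcal{K})$, so that for each $P\in Y$ the number $t_P$ of hyperplanes of $\mathcal{K}$ containing $P$ equals $e_P+1$.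
   Context: $K$ is a field of characteristic zero, $n\ge2$, $S=K[x_0,\dots,x_n]$ with the standard grading. For a codimension two linear subspace $P$, $I_P\subset S$ is its homogeneous ideal and $\ell_P$ is a linear form defining the hyperplane spanned by $P$ and $Q$. "General" means in a suitable nonempty Zariski-open subset (depending on $Y$). For a linear form $\ell=\sum a_ix_i$, put $\frac{\partial f}{\partial\ell}=\sum_i a_i\frac{\partial f}{\partial x_i}$ and $\ell^\vee=(a_0:\dots:a_n)$; for $Q=(a_0:\dots:a_n)$, $Q^\vee=\sum a_ix_i$ (up to scalar), so its dual point is $Q$. A hyperplane arrangement $\mathcal{A}\subset\mathbb{P}^n$ is a finite set of distinct hyperplanes defined by the product $f_{\mathcal{A}}$ of linear forms; $\mathrm{Jac}(f_{\mathcal{A}})$ is generated by its first partial derivatives; its general residual with respect to a general $\ell$ is $r_{\mathcal{A}}=(f_{\mathcal{A}},\frac{\partial f_{\mathcal{A}}}{\partial\ell}):\mathrm{Jac}(f_{\mathcal{A}})$. $S(\mathcal{A})=\{H\cap H':H\neq H'\in\mathcal{A}\}$. *)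

theory Defs
  imports "HOL-Analysis.Analysis" "HOL-Library.Poly_Mapping"
begin

text \<open>
  The variables are indexed by a finite type \<open>'n\<close>; projective n-space corresponds to
  \<open>CARD('n) = n + 1\<close>.  A point is given by homogeneous coordinates, a nonzero vector of
  \<open>'k^'n\<close>, and a linear subspace by its affine cone, a vector subspace of \<open>'k^'n\<close>, which has
  the same codimension.
\<close>

type_synonym ('k, 'n) polys = "('n \<Rightarrow>\<^sub>0 nat) \<Rightarrow>\<^sub>0 'k"


subsection \<open>Polynomials\<close>

definition poly_eval :: "('k::comm_ring_1, 'n::finite) polys \<Rightarrow> 'k ^ 'n \<Rightarrow> 'k" where
  "poly_eval f v =
     (\<Sum>m\<in>Poly_Mapping.keys f. Poly_Mapping.lookup f m * (\<Prod>i\<in>UNIV. (v $ i) ^ Poly_Mapping.lookup m i))"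

definition homogeneous :: "('k::comm_ring_1, 'n::finite) polys \<Rightarrow> bool" where
  "homogeneous f \<longleftrightarrow> (\<exists>d. \<forall>m\<in>Poly_Mapping.keys f. (\<Sum>i\<in>UNIV. Poly_Mapping.lookup m i) = d)"

definition partial :: "'n::finite \<Rightarrow> ('k::comm_ring_1, 'n) polys \<Rightarrow> ('k, 'n) polys" where
  "partial i f =
     (\<Sum>m\<in>Poly_Mapping.keys f.
        Poly_Mapping.single (m - Poly_Mapping.single i 1)
          (of_nat (Poly_Mapping.lookup m i) * Poly_Mapping.lookup f m))"

text \<open>The linear form \<open>\<Sum>i. a\<^sub>i x\<^sub>i\<close>; for a point \<open>Q\<close> this is the dual form of \<open>Q\<close>.\<close>

definition linear_form :: "'k ^ 'n \<Rightarrow> ('k::comm_ring_1, 'n::finite) polys" where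
  "linear_form a = (\<Sum>i\<in>UNIV. Poly_Mapping.single (Poly_Mapping.single i 1) (a $ i))"

definition dual_point :: "('k::comm_ring_1, 'n::finite) polys \<Rightarrow> 'k ^ 'n" where
  "dual_point l = (\<chi> i. Poly_Mapping.lookup l (Poly_Mapping.single i 1))"

definition deriv_along :: "('k::comm_ring_1, 'n::finite) polys \<Rightarrow> ('k, 'n) polys \<Rightarrow> ('k, 'n) polys" where
  "deriv_along l f = (\<Sum>i\<in>UNIV. Poly_Mapping.single 0 (dual_point l $ i) * partial i f)"


subsection \<open>Ideals\<close>

text \<open>Ideals are the submodules of the ring regarded as a module over itself.\<close>

definition ideal_gen :: "'a::comm_ring_1 set \<Rightarrow> 'a set" where
  "ideal_gen B = module.span (*) B"

definition ideal_power :: "'a::comm_ring_1 set \<Rightarrow> nat \<Rightarrow> 'a set" where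
  "ideal_power I k = ideal_gen {\<Prod>j<k. a j | a. \<forall>j<k. a j \<in> I}"

definition ideal_colon :: "'a::comm_ring_1 set \<Rightarrow> 'a set \<Rightarrow> 'a set" where
  "ideal_colon I J = {g. \<forall>h\<in>J. g * h \<in> I}"


subsection \<open>Projective geometry\<close>

text \<open>Open sets of points rational over \<open>'k\<close>, as sets of homogeneous coordinate vectors.\<close>

definition zariski_open :: "('k::field ^ 'n::finite) set \<Rightarrow> bool" where
  "zariski_open U \<longleftrightarrow>
     (\<exists>T. (\<forall>F\<in>T. homogeneous F) \<and> U = {v. v \<noteq> 0 \<and> (\<exists>F\<in>T. poly_eval F v \<noteq> 0)})"

definition linear_subspace_codim :: "nat \<Rightarrow> ('k::field ^ 'n::finite) set \<Rightarrow> bool" where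
  "linear_subspace_codim c V \<longleftrightarrow> vec.subspace V \<and> vec.dim V + c = CARD('n)"

abbreviation hyperplane :: "('k::field ^ 'n::finite) set \<Rightarrow> bool" where
  "hyperplane \<equiv> linear_subspace_codim 1"

definition homogeneous_ideal :: "('k::field ^ 'n::finite) set \<Rightarrow> ('k, 'n) polys set" where
  "homogeneous_ideal P = ideal_gen {F. homogeneous F \<and> (\<forall>v\<in>P. poly_eval F v = 0)}"

text \<open>The form is determined up to a nonzero scalar, which is irrelevant for the ideals below.\<close>

definition hyperplane_form :: "('k::field ^ 'n::finite) set \<Rightarrow> ('k, 'n) polys" where
  "hyperplane_form H = linear_form (SOME a. {v. poly_eval (linear_form a) v = 0} = H)"


subsection \<open>Hyperplane arrangements and residuals\<close>

definition arrangement :: "('k::field ^ 'n::finite) set set \<Rightarrow> bool" where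
  "arrangement A \<longleftrightarrow> finite A \<and> (\<forall>H\<in>A. hyperplane H)"

definition arrangement_poly :: "('k::field ^ 'n::finite) set set \<Rightarrow> ('k, 'n) polys" where
  "arrangement_poly A = (\<Prod>H\<in>A. hyperplane_form H)"

definition Jac :: "('k::field, 'n::finite) polys \<Rightarrow> ('k, 'n) polys set" where
  "Jac f = ideal_gen (range (\<lambda>i. partial i f))"

definition residual ::
    "('k::field ^ 'n::finite) set set \<Rightarrow> ('k, 'n) polys \<Rightarrow> ('k, 'n) polys set" where
  "residual A l =
     ideal_colon (ideal_gen {arrangement_poly A, deriv_along l (arrangement_poly A)})
       (Jac (arrangement_poly A))"

text \<open>
  \<open>G A\<close> is the nonempty Zariski-open set of (dual points of) linear forms that are regarded as
  general with respect to the arrangement \<open>A\<close>.  With \<open>G A = {v. v \<noteq> 0}\<close> the second conjunct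
  only says that the form is nonzero.
\<close>

definition general_residual ::
    "(('k::field ^ 'n::finite) set set \<Rightarrow> ('k ^ 'n) set) \<Rightarrow> ('k, 'n) polys set \<Rightarrow>
      ('k ^ 'n) set set \<Rightarrow> ('k, 'n) polys \<Rightarrow> bool" where
  "general_residual G I A l \<longleftrightarrow> arrangement A \<and> dual_point l \<in> G A \<and> I = residual A l"

definition codim2_intersections :: "('k::field ^ 'n::finite) set set \<Rightarrow> ('k ^ 'n) set set" where
  "codim2_intersections A = {H \<inter> H' | H H'. H \<in> A \<and> H' \<in> A \<and> H \<noteq> H'}"


subsection \<open>The ideal and the hyperplanes determined by \<open>Y\<close> and \<open>E\<close>\<close>

definition residual_like_ideal ::
    "('k::field ^ 'n::finite) set set \<Rightarrow> (('k ^ 'n) set \<Rightarrow> nat) \<Rightarrow> 'k ^ 'n \<Rightarrow> ('k, 'n) polys set" where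
  "residual_like_ideal Y E Q =
     (\<Inter>P\<in>Y. ideal_gen (insert (hyperplane_form (vec.span (insert Q P)))
                               (ideal_power (homogeneous_ideal P) (E P))))"

definition spanned_hyperplanes :: "('k::field ^ 'n::finite) set set \<Rightarrow> ('k ^ 'n) set set" where
  "spanned_hyperplanes Y =
     {H. hyperplane H \<and> (\<exists>P\<in>Y. \<exists>P'\<in>Y. P \<noteq> P' \<and> H = vec.span (P \<union> P'))}"

definition weight_sum ::
    "('k::field ^ 'n::finite) set set \<Rightarrow> (('k ^ 'n) set \<Rightarrow> nat) \<Rightarrow> ('k ^ 'n) set \<Rightarrow> nat" where
  "weight_sum Y E H = (\<Sum>P | P \<in> Y \<and> P \<subseteq> H. E P)"

definition dnum :: "('k::field ^ 'n::finite) set set \<Rightarrow> (('k ^ 'n) set \<Rightarrow> nat) \<Rightarrow> nat" where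
  "dnum Y E = (if spanned_hyperplanes Y = {} then 1
               else Max (weight_sum Y E ` spanned_hyperplanes Y) + 1)"

definition max_hyperplanes ::
    "('k::field ^ 'n::finite) set set \<Rightarrow> (('k ^ 'n) set \<Rightarrow> nat) \<Rightarrow> ('k ^ 'n) set set" where
  "max_hyperplanes Y E = {H \<in> spanned_hyperplanes Y. weight_sum Y E H = dnum Y E - 1}"

definition num_containing :: "('k::field ^ 'n::finite) set set \<Rightarrow> ('k ^ 'n) set \<Rightarrow> nat" where
  "num_containing A P = card {H \<in> A. P \<subseteq> H}"

end

theory Submission
  imports Defs "HOL-Computational_Algebra.Polynomial"
begin

text \<open>
  Let \<open>A\<close> be an arrangement none of whose hyperplanes contains \<open>Q\<close>, with defining form \<open>f\<close> whose
  linear factors take the value 1 at \<open>Q\<close>, and let \<open>J = (f, D f)\<close>, where \<open>D\<close> is the derivative in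
  direction \<open>Q\<close>.  The ideal \<open>J\<close> is unmixed in the following concrete sense: if \<open>b\<close> is a linear form
  vanishing at \<open>Q\<close> and \<open>b w\<close> lies in \<open>J\<close>, then \<open>w\<close> lies in \<open>J\<close> as soon as, for each \<open>H\<close> in \<open>A\<close>, some
  multiple \<open>m w\<close> lies in \<open>J\<close> with \<open>m\<close> not vanishing on \<open>H \<inter> {b = 0}\<close>.  As a product of such forms \<open>b\<close>
  maps all partial derivatives of \<open>f\<close> into \<open>J\<close>, the residual can be computed pencil by pencil.  In a
  pencil of \<open>t\<close> hyperplanes through \<open>P\<close> the form \<open>f\<close> is binary and Euler's relation gives the ideal
  \<open>(\<ell>\<^sub>P, I\<^sub>P ^ (t - 1))\<close>.  Hence the residual of \<open>A\<close> is the residual-like ideal of \<open>S(A)\<close> with exponents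
  \<open>t\<^sub>P - 1\<close>.

  Testing membership along the subspaces \<open>P\<close> recovers \<open>Y\<close> and \<open>E\<close> from \<open>I(Y, E)\<close>, so that (i) forces
  \<open>Y = S(A)\<close> and \<open>e\<^sub>P = t\<^sub>P - 1\<close>; an arrangement with a hyperplane \<open>H\<close> through \<open>Q\<close> is impossible, as
  its residual consists of multiples of the form of \<open>H\<close>.  Finally the sum of \<open>t\<^sub>P - 1\<close> over the \<open>P\<close> in
  a hyperplane is \<open>|A| - 1\<close> for the members of \<open>A\<close> and smaller for all other hyperplanes spanned by two
  elements of \<open>S(A)\<close>, which identifies \<open>A\<close> with \<open>\<K>\<close>.  The point \<open>Q\<close> only has to avoid \<open>Y\<close> and
  \<open>\<L>\<close> and to be general for the finitely many arrangements contained in \<open>\<L>\<close>.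
\<close>

section \<open>The pairing of coefficient vectors with points\<close>

notation scalar_product (infixl "\<odot>" 70)

abbreviation const_poly :: "'k \<Rightarrow> ('k::comm_ring_1, 'n::finite) polys" where
  "const_poly c \<equiv> Poly_Mapping.single 0 c"

lemma scalar_product_add_left: "(a + b) \<odot> v = a \<odot> v + b \<odot> v"
  and scalar_product_add_right: "a \<odot> (v + w) = a \<odot> v + a \<odot> w"
  and scalar_product_zero_left [simp]: "0 \<odot> v = 0"
  and scalar_product_zero_right [simp]: "a \<odot> 0 = 0"
  for a b v w :: "'k::comm_ring_1 ^ 'n::finite"
  by (simp_all add: scalar_product_def sum.distrib algebra_simps)

lemma scalar_product_diff_left: "(a - b) \<odot> v = a \<odot> v - b \<odot> v"
  and scalar_product_diff_right: "a \<odot> (v - w) = a \<odot> v - a \<odot> w"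
  for a b v w :: "'k::comm_ring_1 ^ 'n::finite"
  by (simp_all add: scalar_product_def sum_subtractf algebra_simps)

lemma scalar_product_scale_left: "(c *s a) \<odot> v = c * (a \<odot> v)"
  and scalar_product_scale_right: "a \<odot> (c *s v) = c * (a \<odot> v)"
  for a v :: "'k::comm_ring_1 ^ 'n::finite"
  by (simp_all add: scalar_product_def sum_distrib_left algebra_simps)

lemmas scalar_product_simps =
  scalar_product_add_left scalar_product_add_right scalar_product_diff_left
  scalar_product_diff_right scalar_product_scale_left scalar_product_scale_right

lemma scalar_product_axis: "a \<odot> axis i 1 = a $ i" for a :: "'k::comm_ring_1 ^ 'n::finite"
  by (simp add: scalar_product_def axis_def if_distrib cong: if_cong)

lemma scalar_product_axis': "axis i 1 \<odot> a = a $ i" for a :: "'k::comm_ring_1 ^ 'n::finite"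
  by (simp add: scalar_product_def axis_def if_distrib if_distribR cong: if_cong)

lemma scalar_product_eqI:
  fixes a b :: "'k::comm_ring_1 ^ 'n::finite"
  assumes "\<And>v. a \<odot> v = b \<odot> v"
  shows "a = b"
  using assms by (metis scalar_product_axis vec_eq_iff)


subsection \<open>Evaluation and differentiation\<close>

lemma polys_eq_sum_monomials:
  fixes f :: "('k::comm_ring_1, 'n::finite) polys"
  shows "f = (\<Sum>m\<in>Poly_Mapping.keys f. Poly_Mapping.single m (Poly_Mapping.lookup f m))"
  by (rule poly_mapping_eqI)
    (auto simp: lookup_sum lookup_single when_def in_keys_iff)

lemma polys_induct_monomial [case_names monomial add]:
  fixes f :: "('k::comm_ring_1, 'n::finite) polys"
  assumes "\<And>m c. P (Poly_Mapping.single m c)"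
    and "\<And>f g. P f \<Longrightarrow> P g \<Longrightarrow> P (f + g)"
  shows "P f"
proof -
  have "P (\<Sum>m\<in>A. Poly_Mapping.single m (Poly_Mapping.lookup f m))" if "finite A" for A
    using that
  proof induction
    case empty
    show ?case using assms(1)[of 0 0] by simp
  qed (simp add: assms)
  then show ?thesis by (subst polys_eq_sum_monomials) simp
qed

lemma poly_eval_superset:
  assumes "finite M" "Poly_Mapping.keys f \<subseteq> M"
  shows "poly_eval f v =
    (\<Sum>m\<in>M. Poly_Mapping.lookup f m * (\<Prod>i\<in>UNIV. (v $ i) ^ Poly_Mapping.lookup m i))"
  unfolding poly_eval_def using assms
  by (intro sum.mono_neutral_left) (auto simp: in_keys_iff)

lemma poly_eval_add [simp]: "poly_eval (f + g) v = poly_eval f v + poly_eval g v"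
proof -
  let ?M = "Poly_Mapping.keys f \<union> Poly_Mapping.keys g"
  have "Poly_Mapping.keys (f + g) \<subseteq> ?M" by (rule keys_add)
  then show ?thesis
    by (simp add: poly_eval_superset[of ?M] lookup_add sum.distrib algebra_simps)
qed

lemma poly_eval_single:
  "poly_eval (Poly_Mapping.single m c) v = c * (\<Prod>i\<in>UNIV. (v $ i) ^ Poly_Mapping.lookup m i)"
  by (simp add: poly_eval_superset[of "{m}"])

lemma poly_eval_0 [simp]: "poly_eval 0 v = 0"
  by (simp add: poly_eval_def)

lemma poly_eval_const [simp]: "poly_eval (const_poly c) v = c"
  by (simp add: poly_eval_single)

lemma poly_eval_1 [simp]: "poly_eval 1 v = 1"
  by (metis poly_eval_const single_one)

lemma poly_eval_mult [simp]: "poly_eval (f * g) v = poly_eval f v * poly_eval g v"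
proof (induction f rule: polys_induct_monomial)
  case (monomial m c)
  show ?case
  proof (induction g rule: polys_induct_monomial)
    case (monomial m' c')
    show ?case
      by (simp add: mult_single poly_eval_single lookup_add power_add prod.distrib)
  qed (simp add: algebra_simps)
qed (simp add: algebra_simps)

lemma poly_eval_uminus [simp]: "poly_eval (- f) v = - poly_eval f v"
  using poly_eval_add[of f "- f" v] by (simp add: eq_neg_iff_add_eq_0 add.commute)

lemma poly_eval_diff [simp]: "poly_eval (f - g) v = poly_eval f v - poly_eval g v"
  using poly_eval_add[of f "- g" v] by simp

lemma poly_eval_sum [simp]: "poly_eval (sum f A) v = (\<Sum>x\<in>A. poly_eval (f x) v)"
  by (induction A rule: infinite_finite_induct) simp_all

lemma poly_eval_prod [simp]: "poly_eval (prod f A) v = (\<Prod>x\<in>A. poly_eval (f x) v)"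
  by (induction A rule: infinite_finite_induct) simp_all

lemma poly_eval_power [simp]: "poly_eval (f ^ k) v = poly_eval f v ^ k"
  by (induction k) simp_all

lemma poly_eval_linear_form [simp]:
  fixes a :: "'k::comm_ring_1 ^ 'n::finite"
  shows "poly_eval (linear_form a) v = a \<odot> v"
proof -
  have "(\<Prod>j\<in>UNIV. v $ j ^ (Suc 0 when i = j)) = v $ i" for i :: 'n
    by (subst prod.remove[of _ i]) (auto intro!: prod.neutral)
  then show ?thesis
    by (simp add: linear_form_def scalar_product_def poly_eval_single lookup_single)
qed

lemma linear_form_add: "linear_form (a + b) = linear_form a + linear_form b"
  by (simp add: linear_form_def single_add sum.distrib)

lemma linear_form_scale: "linear_form (c *s a) = const_poly c * linear_form a"
  by (simp add: linear_form_def sum_distrib_left mult_single)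

lemma linear_form_diff: "linear_form (a - b) = linear_form a - linear_form b"
  using linear_form_add[of "a - b" b] by simp

lemma linear_form_axis: "linear_form (axis i 1) = Poly_Mapping.single (Poly_Mapping.single i 1) 1"
  by (simp add: linear_form_def axis_def if_distrib cong: if_cong)

lemma lookup_linear_form:
  fixes a :: "'k::comm_ring_1 ^ 'n::finite"
  shows "Poly_Mapping.lookup (linear_form a) (Poly_Mapping.single i (Suc 0)) = a $ i"
proof -
  have "Poly_Mapping.single j (Suc 0) = Poly_Mapping.single i (Suc 0) \<longleftrightarrow> j = i" for j :: 'n
    by (metis One_nat_def lookup_single_eq lookup_single_not_eq zero_neq_one)
  then show ?thesis
    by (simp add: linear_form_def lookup_sum lookup_single when_def)
qed

lemma dual_point_linear_form [simp]: "dual_point (linear_form a) = a"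
  by (simp add: dual_point_def lookup_linear_form vec_eq_iff)

lemma monomial_eq_prod:
  fixes m :: "'n::finite \<Rightarrow>\<^sub>0 nat" and c :: "'k::comm_ring_1"
  shows "Poly_Mapping.single m c =
     const_poly c * (\<Prod>i\<in>UNIV. linear_form (axis i 1) ^ Poly_Mapping.lookup m i)"
proof -
  have pow: "(Poly_Mapping.single (m' :: 'n \<Rightarrow>\<^sub>0 nat) (1 :: 'k)) ^ k =
      Poly_Mapping.single (\<Sum>_<k. m') 1" for m' k
    by (induction k) (simp_all add: mult_single add.commute)
  have prod: "(\<Prod>i\<in>A. Poly_Mapping.single (h i) (1 :: 'k)) = Poly_Mapping.single (sum h A) 1"
    if "finite A" for h :: "'n \<Rightarrow> 'n \<Rightarrow>\<^sub>0 nat" and A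
    using that by induction (simp_all add: mult_single)
  have "(\<Sum>i\<in>UNIV. \<Sum>_<Poly_Mapping.lookup m i. Poly_Mapping.single i (1::nat)) = m"
    by (rule poly_mapping_eqI) (simp add: lookup_sum lookup_single when_def if_distrib cong: if_cong)
  then show ?thesis
    by (simp add: linear_form_axis pow prod mult_single)
qed

text \<open>Reduces assertions about all polynomials to constants and linear forms. Restriction to a
  line and composition with a projection are constructed by this induction.\<close>

lemma polys_induct [case_names const linear add mult]:
  fixes f :: "('k::comm_ring_1, 'n::finite) polys"
  assumes const: "\<And>c. P (const_poly c)" and linear: "\<And>a. P (linear_form a)"
    and add: "\<And>f g. P f \<Longrightarrow> P g \<Longrightarrow> P (f + g)"
    and mult: "\<And>f g. P f \<Longrightarrow> P g \<Longrightarrow> P (f * g)"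
  shows "P f"
proof (induction f rule: polys_induct_monomial)
  case (monomial m c)
  have pow: "P (g ^ k)" if "P g" for g k
    by (induction k) (use const[of 1] mult that in auto)
  have "P (\<Prod>i\<in>A. linear_form (axis i 1) ^ Poly_Mapping.lookup m i)" if "finite A" for A
    using that by induction (use const[of 1] mult pow linear in auto)
  then show ?case by (subst monomial_eq_prod) (simp add: mult const)
qed (rule add)

lemma partial_superset:
  assumes "finite M" "Poly_Mapping.keys f \<subseteq> M"
  shows "partial i f = (\<Sum>m\<in>M. Poly_Mapping.single (m - Poly_Mapping.single i 1)
          (of_nat (Poly_Mapping.lookup m i) * Poly_Mapping.lookup f m))"
  unfolding partial_def using assms
  by (intro sum.mono_neutral_left) (auto simp: in_keys_iff)

lemma partial_add: "partial i (f + g) = partial i f + partial i g"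
proof -
  let ?M = "Poly_Mapping.keys f \<union> Poly_Mapping.keys g"
  have "Poly_Mapping.keys (f + g) \<subseteq> ?M" by (rule keys_add)
  then show ?thesis
    by (simp add: partial_superset[of ?M] lookup_add sum.distrib algebra_simps single_add)
qed

lemma partial_single:
  "partial i (Poly_Mapping.single m c) =
     Poly_Mapping.single (m - Poly_Mapping.single i 1) (of_nat (Poly_Mapping.lookup m i) * c)"
  by (simp add: partial_superset[of "{m}"])

lemma partial_mult:
  fixes f g :: "('k::comm_ring_1, 'n::finite) polys"
  shows "partial i (f * g) = partial i f * g + f * partial i g"
proof (induction f rule: polys_induct_monomial)
  case (monomial m c)
  show ?case
  proof (induction g rule: polys_induct_monomial)
    case (monomial m' c')
    let ?e = "Poly_Mapping.single i (1::nat)"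
    \<comment> \<open>Truncated subtraction of \<open>?e\<close> commutes with adding
      \<open>m2\<close> only if the variable \<open>i\<close> occurs in \<open>m1\<close>; if it
      does not, both coefficients are zero.\<close>
    have shift: "Poly_Mapping.single (m1 + m2 - ?e) (of_nat (Poly_Mapping.lookup m1 i) * a) =
        Poly_Mapping.single ((m1 - ?e) + m2) (of_nat (Poly_Mapping.lookup m1 i) * a)"
      for m1 m2 :: "'n \<Rightarrow>\<^sub>0 nat" and a :: 'k
    proof (cases "Poly_Mapping.lookup m1 i = 0")
      case False
      then have "m1 + m2 - ?e = (m1 - ?e) + m2"
        by (intro poly_mapping_eqI) (auto simp: lookup_add lookup_minus lookup_single when_def)
      then show ?thesis by simp
    qed simp
    show ?case
      using shift[of m m' "c * c'"] shift[of m' m "c * c'"]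
      by (simp add: mult_single partial_single lookup_add algebra_simps single_add)
  qed (simp add: algebra_simps partial_add)
qed (simp add: algebra_simps partial_add)

lemma partial_const [simp]: "partial i (const_poly c) = 0"
  by (simp add: partial_single)

lemma partial_linear_form [simp]:
  fixes a :: "'k::comm_ring_1 ^ 'n::finite"
  shows "partial i (linear_form a) = const_poly (a $ i)"
proof -
  have "partial i (linear_form a) = (\<Sum>j\<in>UNIV. partial i (Poly_Mapping.single (Poly_Mapping.single j 1) (a $ j)))"
  proof -
    have "partial i (sum h A) = (\<Sum>j\<in>A. partial i (h j))" if "finite A" for h :: "'n \<Rightarrow> ('k, 'n) polys" and A
      using that by induction (simp_all add: partial_add partial_def[of i 0])
    then show ?thesis by (simp add: linear_form_def)
  qed
  also have "\<dots> = (\<Sum>j\<in>UNIV. if j = i then const_poly (a $ j) else 0)"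
    by (intro sum.cong) (auto simp: partial_single lookup_single when_def)
  finally show ?thesis by simp
qed

text \<open>A derivative along a linear form is the directional derivative along its coefficient
  vector, so the dual form of \<open>Q\<close> differentiates in direction \<open>Q\<close>.\<close>

abbreviation dir_deriv :: "'k ^ 'n \<Rightarrow> ('k::comm_ring_1, 'n::finite) polys \<Rightarrow> ('k, 'n) polys" where
  "dir_deriv v \<equiv> deriv_along (linear_form v)"

lemma dir_deriv_eq: "dir_deriv v f = (\<Sum>i\<in>UNIV. const_poly (v $ i) * partial i f)"
  by (simp add: deriv_along_def)

lemma dir_deriv_mult: "dir_deriv v (f * g) = dir_deriv v f * g + f * dir_deriv v g"
  by (simp add: dir_deriv_eq partial_mult sum.distrib sum_distrib_left sum_distrib_right algebra_simps)

lemma dir_deriv_const [simp]: "dir_deriv v (const_poly c) = 0"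
  by (simp add: dir_deriv_eq)

lemma dir_deriv_1 [simp]: "dir_deriv v 1 = 0"
  by (metis dir_deriv_const single_one)

lemma const_poly_sum: "const_poly (sum h A) = (\<Sum>x\<in>A. const_poly (h x))"
  by (induction A rule: infinite_finite_induct) (simp_all add: single_add)

lemma dir_deriv_linear_form [simp]: "dir_deriv v (linear_form a) = const_poly (a \<odot> v)"
  by (simp add: dir_deriv_eq scalar_product_def const_poly_sum mult_single mult.commute)

lemma dir_deriv_axis: "dir_deriv (axis i 1) f = partial i f"
proof -
  have "dir_deriv (axis i 1) f = (\<Sum>j\<in>UNIV. if j = i then partial j f else 0)"
    unfolding dir_deriv_eq by (intro sum.cong) (auto simp: axis_def)
  then show ?thesis by simp
qed

lemma dir_deriv_prod:
  assumes "finite A"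
  shows "dir_deriv v (prod h A) = (\<Sum>x\<in>A. dir_deriv v (h x) * prod h (A - {x}))"
  using assms
proof induction
  case (insert y A)
  have "prod h (insert y A - {x}) = h y * prod h (A - {x})" if "x \<in> A" for x
  proof -
    have "insert y A - {x} = insert y (A - {x})" using insert that by auto
    then show ?thesis using insert by simp
  qed
  moreover have "insert y A - {y} = A" using insert by auto
  ultimately show ?case
    using insert by (simp add: dir_deriv_mult sum_distrib_left algebra_simps)
qed simp

subsection \<open>Polynomials over an infinite field\<close>

lemma poly_eval_on_line:
  fixes F :: "('k::field, 'n::finite) polys"
  shows "\<exists>p. \<forall>t. poly p t = poly_eval F (v + t *s w)"
proof (induction F rule: polys_induct)
  case (const c)
  have "\<forall>t. poly [:c:] t = poly_eval (const_poly c) (v + t *s w)" by simp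
  then show ?case by blast
next
  case (linear a)
  have "\<forall>t. poly [:a \<odot> v, a \<odot> w:] t = poly_eval (linear_form a) (v + t *s w)"
    by (simp add: scalar_product_simps)
  then show ?case by blast
next
  case (add f g)
  then obtain p q where "\<forall>t. poly p t = poly_eval f (v + t *s w)"
    "\<forall>t. poly q t = poly_eval g (v + t *s w)" by blast
  then have "\<forall>t. poly (p + q) t = poly_eval (f + g) (v + t *s w)" by simp
  then show ?case by blast
next
  case (mult f g)
  then obtain p q where "\<forall>t. poly p t = poly_eval f (v + t *s w)"
    "\<forall>t. poly q t = poly_eval g (v + t *s w)" by blast
  then have "\<forall>t. poly (p * q) t = poly_eval (f * g) (v + t *s w)" by simp
  then show ?case by blast
qed

text \<open>Irreducibility of a linear subspace: on the line through \<open>v\<close> and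
  \<open>w\<close> both factors restrict to nonzero univariate polynomials, whose product has
  finitely many roots in an infinite field.\<close>

lemma subspace_nonvanishing_mult:
  fixes F G :: "('k::field_char_0, 'n::finite) polys"
  assumes "vec.subspace W" "v \<in> W" "poly_eval F v \<noteq> 0" "w \<in> W" "poly_eval G w \<noteq> 0"
  shows "\<exists>u\<in>W. poly_eval (F * G) u \<noteq> 0"
proof -
  obtain p where p: "\<And>t. poly p t = poly_eval F (v + t *s (w - v))"
    using poly_eval_on_line by metis
  obtain q where q: "\<And>t. poly q t = poly_eval G (v + t *s (w - v))"
    using poly_eval_on_line by metis
  have "poly p 0 \<noteq> 0" "poly q 1 \<noteq> 0" using assms by (simp_all add: p q)
  then have "p * q \<noteq> 0" by auto
  then have "finite {t. poly (p * q) t = 0}" by (rule poly_roots_finite)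
  then obtain t where "poly (p * q) t \<noteq> 0"
    using infinite_UNIV_char_0 by (metis (mono_tags) UNIV_eq_I mem_Collect_eq)
  moreover have "v + t *s (w - v) \<in> W"
    by (intro vec.subspace_add vec.subspace_scale vec.subspace_diff assms)
  ultimately show ?thesis by (auto simp: p q)
qed

lemma subspace_nonvanishing_prod:
  fixes F :: "'i \<Rightarrow> ('k::field_char_0, 'n::finite) polys"
  assumes "vec.subspace W" "\<And>x. x \<in> A \<Longrightarrow> \<exists>v\<in>W. poly_eval (F x) v \<noteq> 0"
  shows "\<exists>v\<in>W. poly_eval (prod F A) v \<noteq> 0"
  using assms(2)
proof (induction A rule: infinite_finite_induct)
  case (insert x A)
  then obtain v w where "v \<in> W" "poly_eval (F x) v \<noteq> 0" "w \<in> W" "poly_eval (prod F A) w \<noteq> 0"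
    by blast
  from subspace_nonvanishing_mult[OF assms(1) this] show ?case
    using insert by simp
qed (use vec.subspace_0[OF assms(1)] in auto)

text \<open>Induction on the set of variables. With all variables but \<open>j\<close> fixed, the
  sum is a univariate polynomial that vanishes identically; its coefficient at the exponent of
  \<open>m\<close> is the partial sum over \<open>N\<close>, to which the induction hypothesis
  applies.\<close>

lemma monomials_linearly_independent:
  fixes c :: "('n \<Rightarrow>\<^sub>0 nat) \<Rightarrow> 'k::field_char_0"
  assumes "finite I" "finite M"
    and "\<And>m m'. m \<in> M \<Longrightarrow> m' \<in> M \<Longrightarrow>
      (\<forall>i\<in>I. Poly_Mapping.lookup m i = Poly_Mapping.lookup m' i) \<Longrightarrow> m = m'"
    and "\<And>x :: 'n \<Rightarrow> 'k. (\<Sum>m\<in>M. c m * (\<Prod>i\<in>I. x i ^ Poly_Mapping.lookup m i)) = 0"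
    and "m \<in> M"
  shows "c m = 0"
  using assms
proof (induction I arbitrary: M m rule: finite_induct)
  case empty
  then have "M = {m}" by blast
  then show ?case using empty by simp
next
  case (insert j I)
  define N where "N = {m' \<in> M. Poly_Mapping.lookup m' j = Poly_Mapping.lookup m j}"
  have "(\<Sum>m\<in>N. c m * (\<Prod>i\<in>I. x i ^ Poly_Mapping.lookup m i)) = 0" for x :: "'n \<Rightarrow> 'k"
  proof -
    define d where "d = (\<lambda>m. c m * (\<Prod>i\<in>I. x i ^ Poly_Mapping.lookup m i))"
    define p where "p = (\<Sum>m\<in>M. monom (d m) (Poly_Mapping.lookup m j))"
    have "poly p t = 0" for t
    proof -
      have "(\<Prod>i\<in>insert j I. (x(j := t)) i ^ Poly_Mapping.lookup m i) =
          t ^ Poly_Mapping.lookup m j * (\<Prod>i\<in>I. x i ^ Poly_Mapping.lookup m i)" for m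
      proof -
        have "(\<Prod>i\<in>I. (x(j := t)) i ^ Poly_Mapping.lookup m i) = (\<Prod>i\<in>I. x i ^ Poly_Mapping.lookup m i)"
          using insert by (intro prod.cong) auto
        then show ?thesis using insert by simp
      qed
      then show ?thesis
        using insert.prems(3)[of "x(j := t)"]
        by (simp add: p_def poly_sum poly_monom d_def algebra_simps)
    qed
    then have "p = 0" by (metis poly_all_0_iff_0)
    then have "coeff p (Poly_Mapping.lookup m j) = 0" by simp
    then show ?thesis
      using insert.prems(1) unfolding p_def N_def d_def
      by (simp add: coeff_sum sum.inter_filter)
  qed
  moreover have "finite N" "m \<in> N"
    using insert by (simp_all add: N_def)
  moreover have "m1 = m2" if "m1 \<in> N" "m2 \<in> N"
    "\<forall>i\<in>I. Poly_Mapping.lookup m1 i = Poly_Mapping.lookup m2 i" for m1 m2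
    using that insert.prems(2)[of m1 m2] by (simp add: N_def)
  ultimately show ?case using insert.IH[of N m] by blast
qed

lemma poly_eval_eq_0_imp_0:
  fixes F :: "('k::field_char_0, 'n::finite) polys"
  assumes "\<And>v. poly_eval F v = 0"
  shows "F = 0"
proof -
  have "Poly_Mapping.lookup F m = 0" if "m \<in> Poly_Mapping.keys F" for m
  proof (rule monomials_linearly_independent[of UNIV "Poly_Mapping.keys F"])
    show "(\<Sum>m\<in>Poly_Mapping.keys F. Poly_Mapping.lookup F m * (\<Prod>i\<in>UNIV. x i ^ Poly_Mapping.lookup m i)) = 0"
      for x
      using assms[of "vec_lambda x"] by (simp add: poly_eval_def)
  qed (use that in \<open>auto intro: poly_mapping_eqI\<close>)
  then show ?thesis
    by (metis in_keys_iff lookup_zero poly_mapping_eqI)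
qed

text \<open>\<open>G\<close> is \<open>F\<close> composed with a linear map that moves points along
  \<open>w\<close>; it is the projection onto the zeros of \<open>a\<close> if \<open>a\<close>
  takes the value 1 at \<open>w\<close>. The congruence holds for linear forms and is preserved by
  sums and products.\<close>

lemma poly_eval_projection:
  fixes F :: "('k::field_char_0, 'n::finite) polys"
  shows "\<exists>G. linear_form a dvd F - G \<and> (\<forall>v. poly_eval G v = poly_eval F (v - (a \<odot> v) *s w))"
proof (induction F rule: polys_induct)
  case (const c)
  then show ?case by (intro exI[of _ "const_poly c"]) simp
next
  case (linear b)
  have "linear_form b - linear_form (b - (b \<odot> w) *s a) = linear_form a * const_poly (b \<odot> w)"
    by (simp add: linear_form_diff linear_form_scale)
  then show ?case
    by (intro exI[of _ "linear_form (b - (b \<odot> w) *s a)"])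
      (simp add: scalar_product_simps)
next
  case (add F1 F2)
  then obtain G1 G2 where "linear_form a dvd F1 - G1" "linear_form a dvd F2 - G2"
    "\<forall>v. poly_eval G1 v = poly_eval F1 (v - (a \<odot> v) *s w)"
    "\<forall>v. poly_eval G2 v = poly_eval F2 (v - (a \<odot> v) *s w)" by blast
  then show ?case
    using dvd_add[of "linear_form a" "F1 - G1" "F2 - G2"]
    by (intro exI[of _ "G1 + G2"]) (simp add: algebra_simps)
next
  case (mult F1 F2)
  then obtain G1 G2 where G: "linear_form a dvd F1 - G1" "linear_form a dvd F2 - G2"
    "\<forall>v. poly_eval G1 v = poly_eval F1 (v - (a \<odot> v) *s w)"
    "\<forall>v. poly_eval G2 v = poly_eval F2 (v - (a \<odot> v) *s w)" by blast
  have "F1 * F2 - G1 * G2 = (F1 - G1) * F2 + G1 * (F2 - G2)"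
    by (simp add: algebra_simps)
  then have "linear_form a dvd F1 * F2 - G1 * G2"
    using G(1,2) by (simp add: dvd_add)
  then show ?case
    using G by (intro exI[of _ "G1 * G2"]) simp
qed

lemma exists_scalar_product_1:
  fixes a :: "'k::field ^ 'n::finite"
  assumes "a \<noteq> 0"
  obtains w where "a \<odot> w = 1"
proof -
  obtain i where "a $ i \<noteq> 0" using assms by (auto simp: vec_eq_iff)
  then have "a \<odot> (inverse (a $ i) *s axis i 1) = 1"
    by (simp add: scalar_product_simps scalar_product_axis)
  then show ?thesis by (rule that)
qed

text \<open>If \<open>F\<close> vanishes on the hyperplane, its composite \<open>G\<close> with the
  projection onto the hyperplane is zero, and \<open>F - G\<close> is divisible by the form.\<close>

lemma linear_form_dvd_iff:
  fixes F :: "('k::field_char_0, 'n::finite) polys"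
  assumes "a \<noteq> 0"
  shows "linear_form a dvd F \<longleftrightarrow> (\<forall>v. a \<odot> v = 0 \<longrightarrow> poly_eval F v = 0)"
proof
  assume F: "\<forall>v. a \<odot> v = 0 \<longrightarrow> poly_eval F v = 0"
  obtain w where w: "a \<odot> w = 1" using exists_scalar_product_1[OF assms] .
  obtain G where G: "linear_form a dvd F - G"
    "\<And>v. poly_eval G v = poly_eval F (v - (a \<odot> v) *s w)"
    using poly_eval_projection by metis
  have "poly_eval G v = 0" for v
    using F w by (simp add: G scalar_product_simps)
  then have "G = 0" by (rule poly_eval_eq_0_imp_0)
  then show "linear_form a dvd F" using G by simp
qed auto

text \<open>\<open>x\<close> and \<open>y\<close> are dual to \<open>a\<close> and \<open>b\<close>.
  Projecting along \<open>x\<close> leaves a polynomial that vanishes on all zeros of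
  \<open>b\<close>, because the projection maps them into the common zeros.\<close>

lemma vanishing_two_linear_forms:
  fixes F :: "('k::field_char_0, 'n::finite) polys"
  assumes "a \<odot> x = 1" "a \<odot> y = 0" "b \<odot> x = 0" "b \<odot> y = 1"
    and F: "\<And>v. a \<odot> v = 0 \<Longrightarrow> b \<odot> v = 0 \<Longrightarrow> poly_eval F v = 0"
  shows "\<exists>X Y. F = linear_form a * X + linear_form b * Y"
proof -
  obtain G where G: "linear_form a dvd F - G"
    "\<And>v. poly_eval G v = poly_eval F (v - (a \<odot> v) *s x)"
    using poly_eval_projection by metis
  obtain X where X: "F - G = linear_form a * X" using G(1) by blast
  have "b \<noteq> 0" using assms by auto
  moreover have "poly_eval G v = 0" if "b \<odot> v = 0" for v
    using that assms by (simp add: G scalar_product_simps)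
  ultimately obtain Y where "G = linear_form b * Y"
    using linear_form_dvd_iff by blast
  with X have "F = linear_form a * X + linear_form b * Y"
    by (simp add: algebra_simps)
  then show ?thesis by blast
qed

lemma subspace_zeros: "vec.subspace {v. a \<odot> v = 0}" "vec.subspace {v. a \<odot> v = 0 \<and> b \<odot> v = 0}"
  for a b :: "'k::field ^ 'n::finite"
  by (simp_all add: vec.subspace_def scalar_product_simps)

text \<open>By irreducibility of the hyperplane, two polynomials that are not identically zero on it
  have a product that is not identically zero on it.\<close>

lemma linear_form_prime:
  fixes F G :: "('k::field_char_0, 'n::finite) polys"
  assumes "a \<noteq> 0" "linear_form a dvd F * G"
  shows "linear_form a dvd F \<or> linear_form a dvd G"
proof (rule ccontr)
  assume "\<not> ?thesis"
  then obtain v w where "a \<odot> v = 0" "poly_eval F v \<noteq> 0" "a \<odot> w = 0" "poly_eval G w \<noteq> 0"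
    using linear_form_dvd_iff[OF assms(1)] by blast
  then have "\<exists>u\<in>{v. a \<odot> v = 0}. poly_eval (F * G) u \<noteq> 0"
    by (intro subspace_nonvanishing_mult) (auto simp: subspace_zeros)
  then show False using assms linear_form_dvd_iff[OF assms(1)] by blast
qed

lemma linear_form_dvd_prod:
  fixes F :: "'i \<Rightarrow> ('k::field_char_0, 'n::finite) polys"
  assumes "a \<noteq> 0" "finite A" "linear_form a dvd prod F A"
  shows "\<exists>x\<in>A. linear_form a dvd F x"
  using assms(2,3)
proof induction
  case empty
  then show ?case using linear_form_dvd_iff[OF assms(1), of 1] by (auto dest: spec[of _ 0])
next
  case (insert x A)
  then show ?case using linear_form_prime[OF assms(1), of "F x" "prod F A"] by auto
qed

text \<open>Primes none of which divides another can be split off from \<open>X\<close> one after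
  the other.\<close>

lemma prod_linear_forms_dvd:
  fixes X :: "('k::field_char_0, 'n::finite) polys"
  assumes "finite A" "0 \<notin> A" "\<And>a. a \<in> A \<Longrightarrow> linear_form a dvd X"
    and "\<And>a b. a \<in> A \<Longrightarrow> b \<in> A \<Longrightarrow> a \<noteq> b \<Longrightarrow> \<not> linear_form a dvd linear_form b"
  shows "prod linear_form A dvd X"
  using assms
proof (induction A rule: finite_induct)
  case (insert a A)
  then obtain Z where Z: "X = prod linear_form A * Z" by (auto elim!: dvdE)
  have "a \<noteq> 0" using insert by auto
  moreover have "\<not> linear_form a dvd prod linear_form A"
    using linear_form_dvd_prod[OF \<open>a \<noteq> 0\<close> insert.hyps(1), of linear_form] insert by blast
  ultimately have "linear_form a dvd Z"
    using linear_form_prime[of a "prod linear_form A" Z] insert.prems(2)[of a] Z by auto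
  then show ?case using Z insert by (auto simp: mult.commute intro: mult_dvd_mono)
qed simp


subsection \<open>Ideals\<close>

lemma module_mult: "module ((*) :: 'a::comm_ring_1 \<Rightarrow> 'a \<Rightarrow> 'a)"
  by unfold_locales (simp_all add: algebra_simps)

lemma in_ideal_gen_two:
  fixes a b z :: "'a::comm_ring_1"
  shows "z \<in> ideal_gen {a, b} \<longleftrightarrow> (\<exists>p q. z = p * a + q * b)"
proof -
  have "z \<in> ideal_gen {a, b} \<longleftrightarrow> (\<exists>p q. z - p * a - q * b = 0)"
    unfolding ideal_gen_def module.span_breakdown_eq[OF module_mult]
    by (simp add: module.span_empty[OF module_mult])
  also have "\<dots> \<longleftrightarrow> (\<exists>p q. z = p * a + q * b)"
    by (simp add: diff_diff_eq)
  finally show ?thesis .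
qed

lemma ideal_gen_base: "x \<in> B \<Longrightarrow> x \<in> ideal_gen B"
  and ideal_gen_0: "0 \<in> ideal_gen B"
  and ideal_gen_add: "x \<in> ideal_gen B \<Longrightarrow> y \<in> ideal_gen B \<Longrightarrow> x + y \<in> ideal_gen B"
  and ideal_gen_diff: "x \<in> ideal_gen B \<Longrightarrow> y \<in> ideal_gen B \<Longrightarrow> x - y \<in> ideal_gen B"
  and ideal_gen_mult: "x \<in> ideal_gen B \<Longrightarrow> c * x \<in> ideal_gen B"
  and ideal_gen_sum: "(\<And>i. i \<in> I \<Longrightarrow> h i \<in> ideal_gen B) \<Longrightarrow> sum h I \<in> ideal_gen B"
  for B :: "'a::comm_ring_1 set"
  unfolding ideal_gen_def
  by (rule module.span_base[OF module_mult] module.span_zero[OF module_mult]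
      module.span_add[OF module_mult] module.span_diff[OF module_mult]
      module.span_scale[OF module_mult] module.span_sum[OF module_mult]; assumption)+

lemma ideal_gen_subsetI:
  fixes B :: "'a::comm_ring_1 set"
  assumes "B \<subseteq> ideal_gen C"
  shows "ideal_gen B \<subseteq> ideal_gen C"
  using assms unfolding ideal_gen_def
  by (intro module.span_minimal[OF module_mult] module.subspace_span[OF module_mult])

subsection \<open>Products of normalized linear forms\<close>

lemma eq_add_if_diff_eq: "x - y = z \<Longrightarrow> x = y + z" for x y z :: "'a::ab_group_add"
  by (simp add: diff_eq_eq add.commute)

lemma dual_basis_ex:
  fixes a b Q :: "'k::field ^ 'n::finite"
  assumes "a \<odot> Q = 1" "b \<odot> Q = 0" "b \<noteq> 0"
  shows "\<exists>x. b \<odot> x = 1 \<and> a \<odot> x = 0"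
proof -
  obtain w where "b \<odot> w = 1" using exists_scalar_product_1[OF assms(3)] .
  then show ?thesis
    using assms by (intro exI[of _ "w - (a \<odot> w) *s Q"]) (simp add: scalar_product_simps)
qed

text \<open>With the value 1 at \<open>Q\<close>, distinct members are never proportional, the
  derivative in direction \<open>Q\<close> is the plain sum of the cofactors, and differences of
  members vanish at \<open>Q\<close>.\<close>

locale normalized_forms =
  fixes A :: "('k::field_char_0 ^ 'n::finite) set" and Q :: "'k ^ 'n"
  assumes finite_A: "finite A" and normalized: "a \<in> A \<Longrightarrow> a \<odot> Q = 1"
begin

abbreviation form_prod :: "('k, 'n) polys" ("\<Phi>") where
  "\<Phi> \<equiv> prod linear_form A"

lemma nonzero: "a \<in> A \<Longrightarrow> a \<noteq> 0"
  using normalized by fastforce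

text \<open>Every vector is a zero of \<open>a\<close> plus a multiple of \<open>Q\<close>, and both
  forms take the value 1 at \<open>Q\<close>.\<close>

lemma dvd_linear_form_iff:
  assumes "a \<in> A" "b \<in> A"
  shows "linear_form a dvd linear_form b \<longleftrightarrow> a = b"
proof
  assume dvd: "linear_form a dvd linear_form b"
  show "a = b"
  proof (rule scalar_product_eqI)
    fix v
    have "a \<odot> (v - (a \<odot> v) *s Q) = 0" using assms normalized by (simp add: scalar_product_simps)
    then have "b \<odot> (v - (a \<odot> v) *s Q) = 0"
      using dvd linear_form_dvd_iff[OF nonzero[OF assms(1)]] by fastforce
    then show "a \<odot> v = b \<odot> v" using assms normalized by (simp add: scalar_product_simps)
  qed
qed simp

lemma not_dvd_prod_remove:
  assumes "a \<in> A" "C \<subseteq> A" "a \<notin> C"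
  shows "\<not> linear_form a dvd prod linear_form C"
  using linear_form_dvd_prod[OF nonzero[OF assms(1)], of C linear_form] assms
    dvd_linear_form_iff finite_subset[OF _ finite_A] by blast

lemma prod_dvdI:
  assumes "\<And>a. a \<in> A \<Longrightarrow> linear_form a dvd X"
  shows "\<Phi> dvd X"
  using assms finite_A nonzero by (intro prod_linear_forms_dvd) (auto simp: dvd_linear_form_iff)

lemma prod_remove: "a \<in> A \<Longrightarrow> \<Phi> = linear_form a * prod linear_form (A - {a})"
  by (rule prod.remove[OF finite_A])

lemma linear_form_dvd_form_prod: "a \<in> A \<Longrightarrow> linear_form a dvd \<Phi>"
  using finite_A by (intro dvd_prodI)

lemma dir_deriv_form_prod:
  "dir_deriv v \<Phi> = (\<Sum>a\<in>A. const_poly (a \<odot> v) * prod linear_form (A - {a}))"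
  by (simp add: dir_deriv_prod finite_A)

lemma deriv_Q: "dir_deriv Q \<Phi> = (\<Sum>a\<in>A. prod linear_form (A - {a}))"
  by (simp add: dir_deriv_form_prod normalized)

text \<open>Modulo \<open>a\<close> only the cofactor of \<open>a\<close> survives in the
  derivative, and no remaining factor is divisible by \<open>a\<close>.\<close>

lemma not_dvd_deriv_Q:
  assumes "a \<in> A"
  shows "\<not> linear_form a dvd dir_deriv Q \<Phi>"
proof
  assume dvd: "linear_form a dvd dir_deriv Q \<Phi>"
  have "linear_form a dvd (\<Sum>c\<in>A - {a}. prod linear_form (A - {c}))"
    using assms finite_A by (intro dvd_sum dvd_prodI) auto
  moreover have "dir_deriv Q \<Phi> = prod linear_form (A - {a}) + (\<Sum>c\<in>A - {a}. prod linear_form (A - {c}))"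
    by (simp add: deriv_Q sum.remove[OF finite_A assms])
  ultimately have "linear_form a dvd prod linear_form (A - {a})"
    using dvd by (metis dvd_add_left_iff)
  then show False using not_dvd_prod_remove[OF assms, of "A - {a}"] by auto
qed

text \<open>The derivative is coprime to every linear factor of \<open>\<Phi>\<close>, hence a
  nonzerodivisor modulo \<open>\<Phi>\<close>.\<close>

lemma dvd_mult_deriv_Q:
  assumes "\<Phi> dvd X * dir_deriv Q \<Phi>"
  shows "\<Phi> dvd X"
proof (rule prod_dvdI)
  fix a assume "a \<in> A"
  then have "linear_form a dvd X * dir_deriv Q \<Phi>"
    using assms linear_form_dvd_form_prod dvd_trans by blast
  then show "linear_form a dvd X"
    using linear_form_prime nonzero not_dvd_deriv_Q \<open>a \<in> A\<close> by blast
qed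

abbreviation residual_base :: "('k, 'n) polys set" ("J") where
  "J \<equiv> ideal_gen {\<Phi>, dir_deriv Q \<Phi>}"

lemma in_J: "z \<in> J \<longleftrightarrow> (\<exists>p q. z = p * \<Phi> + q * dir_deriv Q \<Phi>)"
  by (rule in_ideal_gen_two)

lemma mult_form_prod_in_J: "c * \<Phi> \<in> J" "\<Phi> * c \<in> J"
  by (auto simp: mult.commute intro: ideal_gen_mult ideal_gen_base)

lemma mult_deriv_in_J: "c * dir_deriv Q \<Phi> \<in> J"
  by (auto intro: ideal_gen_mult ideal_gen_base)

text \<open>Unmixedness of the ideal generated by \<open>b\<close> and a product of members.
  Induction on \<open>C\<close>: the hypothesis at \<open>a\<close> gives
  \<open>z = b X + a Y\<close>; cancelling \<open>a\<close> modulo \<open>b\<close> in the remaining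
  hypotheses turns them into hypotheses on \<open>Y\<close> for the smaller product.\<close>

lemma colon_two:
  assumes b: "b \<noteq> 0" "b \<odot> Q = 0" and "C \<subseteq> A"
    and m: "\<And>a. a \<in> C \<Longrightarrow> \<exists>m. (\<exists>v. b \<odot> v = 0 \<and> a \<odot> v = 0 \<and> poly_eval m v \<noteq> 0) \<and>
      (\<exists>p q. m * z = linear_form b * p + prod linear_form C * q)"
  shows "\<exists>p q. z = linear_form b * p + prod linear_form C * q"
  using finite_subset[OF \<open>C \<subseteq> A\<close> finite_A] \<open>C \<subseteq> A\<close> m
proof (induction C arbitrary: z rule: finite_induct)
  case empty
  then show ?case by (intro exI[of _ 0] exI[of _ z]) simp
next
  case (insert a C)
  have a: "a \<odot> Q = 1" "a \<in> A" using insert normalized by auto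
  obtain m v p q where m: "b \<odot> v = 0" "a \<odot> v = 0" "poly_eval m v \<noteq> 0"
    "m * z = linear_form b * p + prod linear_form (insert a C) * q"
    using insert.prems(2)[of a] by blast
  \<comment> \<open>Otherwise \<open>m z\<close> would be nonzero somewhere on the subspace
    \<open>a = b = 0\<close>, where the right-hand side of its representation vanishes.\<close>
  have "poly_eval z w = 0" if w: "b \<odot> w = 0" "a \<odot> w = 0" for w
  proof (rule ccontr)
    assume "poly_eval z w \<noteq> 0"
    then obtain u where u: "b \<odot> u = 0" "a \<odot> u = 0" "poly_eval (m * z) u \<noteq> 0"
      using subspace_nonvanishing_mult[OF subspace_zeros(2), of v b a m w z] m(1-3) w by auto
    then show False unfolding m(4) using insert.hyps by simp
  qed
  moreover obtain x where "b \<odot> x = 1" "a \<odot> x = 0" using dual_basis_ex a b by blast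
  ultimately obtain X Y where z: "z = linear_form b * X + linear_form a * Y"
    using vanishing_two_linear_forms[of b x Q a z] a b by blast
  have not_dvd: "\<not> linear_form b dvd linear_form a"
    using linear_form_dvd_iff[OF b(1), of "linear_form a"] a b by auto
  have "\<exists>p q. Y = linear_form b * p + prod linear_form C * q"
  proof (rule insert.IH)
    fix c assume "c \<in> C"
    then obtain m v p q where m: "b \<odot> v = 0" "c \<odot> v = 0" "poly_eval m v \<noteq> 0"
      "m * z = linear_form b * p + prod linear_form (insert a C) * q"
      using insert.prems(2)[of c] by blast
    have "linear_form a * (m * Y - prod linear_form C * q) - linear_form b * (p - m * X) =
        m * z - (linear_form b * p + prod linear_form (insert a C) * q)"
      using insert.hyps by (simp add: z algebra_simps)
    then have "linear_form a * (m * Y - prod linear_form C * q) = linear_form b * (p - m * X)"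
      by (simp add: m(4))
    then have "linear_form b dvd linear_form a * (m * Y - prod linear_form C * q)" by simp
    then have "linear_form b dvd m * Y - prod linear_form C * q"
      using linear_form_prime[OF b(1)] not_dvd by blast
    then obtain r where "m * Y - prod linear_form C * q = linear_form b * r" ..
    then have "m * Y = prod linear_form C * q + linear_form b * r" by (rule eq_add_if_diff_eq)
    then have "m * Y = linear_form b * r + prod linear_form C * q" by (simp only: add.commute)
    with m show "\<exists>m. (\<exists>v. b \<odot> v = 0 \<and> c \<odot> v = 0 \<and> poly_eval m v \<noteq> 0) \<and>
        (\<exists>p q. m * Y = linear_form b * p + prod linear_form C * q)" by blast
  qed (use insert in auto)
  then obtain p q where "Y = linear_form b * p + prod linear_form C * q" by blast
  then have "z = linear_form b * (X + linear_form a * p) + prod linear_form (insert a C) * q"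
    using insert.hyps by (simp add: z algebra_simps)
  then show ?case by blast
qed

text \<open>Write \<open>b w = p1 \<Phi> + q1 D\<close> and \<open>m w = p2 \<Phi> + q2 D\<close>,
  where \<open>D\<close> is the derivative of \<open>\<Phi>\<close> in direction \<open>Q\<close>.
  As \<open>D\<close> is a nonzerodivisor modulo \<open>\<Phi>\<close>, \<open>m q1\<close> is
  congruent to \<open>b q2\<close>; so \<open>colon_two\<close> puts \<open>q1\<close> into the
  ideal of \<open>b\<close> and \<open>\<Phi>\<close>, and \<open>b\<close> can be divided
  out.\<close>

lemma J_unmixed:
  assumes b: "b \<noteq> 0" "b \<odot> Q = 0" and bw: "linear_form b * w \<in> J"
    and m: "\<And>a. a \<in> A \<Longrightarrow>
      \<exists>m. (\<exists>v. b \<odot> v = 0 \<and> a \<odot> v = 0 \<and> poly_eval m v \<noteq> 0) \<and> m * w \<in> J"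
  shows "w \<in> J"
proof -
  let ?d = "dir_deriv Q \<Phi>"
  obtain p1 q1 where 1: "linear_form b * w = p1 * \<Phi> + q1 * ?d" using bw in_J by blast
  have "\<exists>p q. q1 = linear_form b * p + \<Phi> * q"
  proof (rule colon_two[OF b order_refl])
    fix a assume "a \<in> A"
    from m[OF this] obtain m v where m: "b \<odot> v = 0" "a \<odot> v = 0" "poly_eval m v \<noteq> 0" "m * w \<in> J"
      by blast
    obtain p2 q2 where 2: "m * w = p2 * \<Phi> + q2 * ?d" using m(4) in_J by blast
    have "(m * q1 - linear_form b * q2) * ?d = \<Phi> * (linear_form b * p2 - m * p1)"
    proof -
      have "(m * q1 - linear_form b * q2) * ?d - \<Phi> * (linear_form b * p2 - m * p1) =
          m * (p1 * \<Phi> + q1 * ?d) - linear_form b * (p2 * \<Phi> + q2 * ?d)"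
        by (simp add: algebra_simps)
      also have "\<dots> = 0"
        unfolding 1[symmetric] 2[symmetric] mult.left_commute[of m "linear_form b"] by (rule diff_self)
      finally show ?thesis by (rule right_minus_eq[THEN iffD1])
    qed
    then have "\<Phi> dvd (m * q1 - linear_form b * q2) * ?d" by (simp only: dvd_triv_left)
    then have "\<Phi> dvd m * q1 - linear_form b * q2" by (rule dvd_mult_deriv_Q)
    then obtain s where "m * q1 - linear_form b * q2 = \<Phi> * s" ..
    then have "m * q1 = linear_form b * q2 + \<Phi> * s" by (rule eq_add_if_diff_eq)
    with m(1-3) show "\<exists>m. (\<exists>v. b \<odot> v = 0 \<and> a \<odot> v = 0 \<and> poly_eval m v \<noteq> 0) \<and>
      (\<exists>p q. m * q1 = linear_form b * p + \<Phi> * q)" by blast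
  qed
  then obtain p q where q1: "q1 = linear_form b * p + \<Phi> * q" by blast
  have "linear_form b * (w - p * ?d) - \<Phi> * (p1 + q * ?d) = linear_form b * w - (p1 * \<Phi> + q1 * ?d)"
    by (simp add: q1 algebra_simps)
  then have eq: "linear_form b * (w - p * ?d) = \<Phi> * (p1 + q * ?d)"
    using 1 by simp
  have "\<Phi> dvd w - p * ?d"
  proof (rule prod_dvdI)
    fix a assume a: "a \<in> A"
    have "linear_form a dvd linear_form b * (w - p * ?d)"
      unfolding eq using linear_form_dvd_form_prod[OF a] by simp
    \<comment> \<open>\<open>b\<close> vanishes at \<open>Q\<close> and \<open>a\<close> does not,
      so divisibility would make \<open>b\<close> vanish everywhere.\<close>
    moreover have "\<not> linear_form a dvd linear_form b"
    proof
      assume "linear_form a dvd linear_form b"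
      then have *: "b \<odot> v = 0" if "a \<odot> v = 0" for v
        using that linear_form_dvd_iff[OF nonzero[OF a], of "linear_form b"] by auto
      have "b \<odot> v = 0" for v
        using *[of "v - (a \<odot> v) *s Q"] b normalized[OF a] by (simp add: scalar_product_simps)
      then show False using b(1) by (metis scalar_product_eqI scalar_product_zero_left)
    qed
    ultimately show "linear_form a dvd w - p * ?d"
      using linear_form_prime[OF nonzero[OF a]] by blast
  qed
  then obtain r where "w - p * ?d = \<Phi> * r" ..
  then have "w = p * ?d + \<Phi> * r" by (rule eq_add_if_diff_eq)
  then have "w = r * \<Phi> + p * ?d" by (simp only: ac_simps)
  then show ?thesis using in_J by blast
qed

text \<open>The factors are stripped off one at a time; the multipliers \<open>m\<close> for
  \<open>w\<close> also serve for \<open>w\<close> times the remaining factors.\<close>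

lemma J_unmixed_prod:
  assumes "finite I" and b: "\<And>i. i \<in> I \<Longrightarrow> b i \<noteq> 0 \<and> b i \<odot> Q = 0"
    and "(\<Prod>i\<in>I. linear_form (b i)) * w \<in> J"
    and m: "\<And>i a. i \<in> I \<Longrightarrow> a \<in> A \<Longrightarrow>
      \<exists>m. (\<exists>v. b i \<odot> v = 0 \<and> a \<odot> v = 0 \<and> poly_eval m v \<noteq> 0) \<and> m * w \<in> J"
  shows "w \<in> J"
  using assms
proof (induction I rule: finite_induct)
  case (insert i I)
  let ?w = "(\<Prod>i\<in>I. linear_form (b i)) * w"
  have "?w \<in> J"
  proof (rule J_unmixed[of "b i"])
    show "linear_form (b i) * ?w \<in> J" using insert.prems(2) insert.hyps by (simp add: mult.assoc)
    fix a assume "a \<in> A"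
    then obtain m v where "b i \<odot> v = 0 \<and> a \<odot> v = 0 \<and> poly_eval m v \<noteq> 0" "m * w \<in> J"
      using insert.prems(3)[of i a] by blast
    moreover from this(2) have "(\<Prod>i\<in>I. linear_form (b i)) * (m * w) \<in> J"
      by (rule ideal_gen_mult)
    then have "m * ?w \<in> J" by (simp only: mult.left_commute)
    ultimately show "\<exists>m. (\<exists>v. b i \<odot> v = 0 \<and> a \<odot> v = 0 \<and> poly_eval m v \<noteq> 0) \<and> m * ?w \<in> J"
      by blast
  qed (use insert.prems(1) in auto)
  then show ?case using insert by auto
qed simp

text \<open>The product plays the role of a discriminant. The square of the cofactor of
  \<open>a\<close> lies in \<open>J\<close>, as it differs from a multiple of the derivative by
  multiples of \<open>\<Phi>\<close>; and \<open>?\<delta> a\<close> is congruent to this cofactor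
  modulo \<open>a\<close>, so it multiplies the cofactor into \<open>J\<close>.\<close>

lemma discriminant_mult_deriv_in_J:
  "(\<Prod>(a, c)\<in>(SIGMA a:A. A - {a}). linear_form (c - a)) * dir_deriv v \<Phi> \<in> J"
proof -
  let ?\<delta> = "\<lambda>a. \<Prod>c\<in>A - {a}. linear_form (c - a)"
  let ?f = "\<lambda>a. prod linear_form (A - {a})"
  have \<Delta>: "(\<Prod>(a, c)\<in>(SIGMA a:A. A - {a}). linear_form (c - a)) = prod ?\<delta> A"
    by (rule prod.Sigma[symmetric]) (use finite_A in auto)
  have "?\<delta> a * ?f a \<in> J" if a: "a \<in> A" for a
  proof -
    have "dir_deriv Q \<Phi> * ?f a - ?f a * ?f a = (\<Sum>c\<in>A - {a}. ?f c * ?f a)"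
      by (simp add: deriv_Q sum.remove[OF finite_A a] algebra_simps sum_distrib_left)
    moreover have "?f c * ?f a \<in> J" if "c \<in> A - {a}" for c
    proof -
      have "?f c = linear_form a * prod linear_form (A - {c} - {a})"
        using that a finite_A by (intro prod.remove) auto
      then have "?f c * ?f a = prod linear_form (A - {c} - {a}) * \<Phi>"
        by (simp add: prod_remove[OF a] ac_simps)
      then show ?thesis by (simp add: mult_form_prod_in_J)
    qed
    ultimately have "dir_deriv Q \<Phi> * ?f a - ?f a * ?f a \<in> J"
      by (auto intro!: ideal_gen_sum)
    then have sq: "?f a * ?f a \<in> J"
      using ideal_gen_diff[OF mult_deriv_in_J[of "?f a"]] by (fastforce simp: ac_simps)
    \<comment> \<open>On the zeros of \<open>a\<close> the forms \<open>c - a\<close> and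
      \<open>c\<close> agree.\<close>
    have "linear_form a dvd ?\<delta> a - ?f a"
      by (subst linear_form_dvd_iff[OF nonzero[OF a]]) (simp add: scalar_product_simps)
    then obtain k where k: "?\<delta> a - ?f a = linear_form a * k" ..
    have "?\<delta> a * ?f a = ?f a * ?f a + (?\<delta> a - ?f a) * ?f a" by (simp add: algebra_simps)
    also have "\<dots> = ?f a * ?f a + k * \<Phi>" by (simp add: k prod_remove[OF a] ac_simps)
    finally show ?thesis using sq by (simp add: ideal_gen_add mult_form_prod_in_J)
  qed
  moreover have "prod ?\<delta> A * ?f a = prod ?\<delta> (A - {a}) * (?\<delta> a * ?f a)" if "a \<in> A" for a
    by (simp add: prod.remove[OF finite_A that, of ?\<delta>] ac_simps)
  ultimately have "prod ?\<delta> A * ?f a \<in> J" if "a \<in> A" for a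
    using that by (simp add: ideal_gen_mult)
  then have "(\<Sum>a\<in>A. const_poly (a \<odot> v) * (prod ?\<delta> A * ?f a)) \<in> J"
    by (rule ideal_gen_sum[OF ideal_gen_mult])
  then show ?thesis
    unfolding \<Delta> dir_deriv_form_prod by (simp add: sum_distrib_left ac_simps)
qed

end

section \<open>Pencils of hyperplanes through a subspace of codimension two\<close>

context normalized_forms
begin

text \<open>For \<open>l\<close> in \<open>A\<close> and \<open>b\<close> vanishing at
  \<open>Q\<close>, these are the members containing the subspace \<open>b = l = 0\<close>:
  comparing values at \<open>Q\<close> shows that the coefficient of \<open>l\<close> must be
  1.\<close>

definition pencil :: "'k ^ 'n \<Rightarrow> 'k ^ 'n \<Rightarrow> ('k ^ 'n) set" where
  "pencil l b = {a \<in> A. \<exists>k. a = l + k *s b}"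

lemma pencil_subset: "pencil l b \<subseteq> A"
  by (auto simp: pencil_def)

lemma self_in_pencil: "l \<in> A \<Longrightarrow> l \<in> pencil l b"
  unfolding pencil_def by (auto intro: exI[of _ 0])

lemma not_dvd_normalized:
  assumes "b \<noteq> 0" "b \<odot> Q = 0" "a \<in> A"
  shows "\<not> linear_form b dvd linear_form a"
  using linear_form_dvd_iff[OF assms(1), of "linear_form a"] assms normalized[of a] by auto

text \<open>Here the forms all lie in one pencil \<open>l + k b\<close>, so that \<open>\<Phi>\<close> is a binary form in \<open>b\<close> and
  \<open>l\<close>, and \<open>\<theta>\<close> is its partial derivative with respect to \<open>b\<close>.\<close>

context
  fixes l b :: "'k ^ 'n" and k :: "'k ^ 'n \<Rightarrow> 'k" and \<theta> :: "('k, 'n) polys"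
  assumes l: "l \<in> A" and b: "b \<noteq> 0" "b \<odot> Q = 0"
    and k: "\<And>a. a \<in> A \<Longrightarrow> a = l + k a *s b"
    and \<theta>: "\<theta> = (\<Sum>a\<in>A. const_poly (k a) * prod linear_form (A - {a}))"
begin

text \<open>The chain rule for a form in \<open>l\<close> and \<open>b\<close>; the derivative in
  direction \<open>Q\<close> is its partial derivative with respect to \<open>l\<close>.\<close>

lemma binary_dir_deriv:
  "dir_deriv v \<Phi> = const_poly (l \<odot> v) * dir_deriv Q \<Phi> + const_poly (b \<odot> v) * \<theta>"
proof -
  have "const_poly (a \<odot> v) * prod linear_form (A - {a}) =
      const_poly (l \<odot> v) * prod linear_form (A - {a}) +
      const_poly (b \<odot> v) * (const_poly (k a) * prod linear_form (A - {a}))" if "a \<in> A" for a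
  proof -
    have "a \<odot> v = l \<odot> v + b \<odot> v * k a"
      by (subst k[OF that]) (simp add: scalar_product_simps)
    then show ?thesis by (simp add: single_add algebra_simps mult_single flip: mult.assoc)
  qed
  then show ?thesis
    by (simp add: dir_deriv_form_prod[of v] deriv_Q \<theta> sum_distrib_left sum.distrib)
qed

text \<open>Euler's relation for a form of degree \<open>card A\<close> in the two variables
  \<open>b\<close> and \<open>l\<close>.\<close>

lemma binary_euler:
  "linear_form b * \<theta> + linear_form l * dir_deriv Q \<Phi> = of_nat (card A) * \<Phi>"
proof -
  have "linear_form b * (const_poly (k a) * prod linear_form (A - {a})) +
      linear_form l * prod linear_form (A - {a}) = \<Phi>" if "a \<in> A" for a
  proof -
    have "linear_form a = linear_form l + const_poly (k a) * linear_form b"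
      by (subst k[OF that]) (simp add: linear_form_add linear_form_scale)
    then show ?thesis by (simp add: prod_remove[OF that] algebra_simps)
  qed
  then have "linear_form b * \<theta> + linear_form l * dir_deriv Q \<Phi> = (\<Sum>a\<in>A. \<Phi>)"
    by (simp add: \<theta> deriv_Q sum_distrib_left flip: sum.distrib)
  then show ?thesis by simp
qed

text \<open>Modulo \<open>b\<close> every member of the pencil is congruent to
  \<open>l\<close>.\<close>

lemma binary_prod_cong:
  assumes "C \<subseteq> A"
  shows "linear_form b dvd prod linear_form C - linear_form l ^ card C"
proof (subst linear_form_dvd_iff[OF b(1)], intro allI impI)
  fix v assume v: "b \<odot> v = 0"
  have "a \<odot> v = l \<odot> v" if "a \<in> C" for a
    using that assms k[of a] v by (metis scalar_product_add_left scalar_product_scale_left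
        mult_zero_right add.right_neutral subsetD)
  then show "poly_eval (prod linear_form C - linear_form l ^ card C) v = 0" by simp
qed

lemma binary_deriv_cong:
  "linear_form b dvd dir_deriv Q \<Phi> - of_nat (card A) * linear_form l ^ (card A - 1)"
proof -
  have "dir_deriv Q \<Phi> - of_nat (card A) * linear_form l ^ (card A - 1) =
      (\<Sum>a\<in>A. prod linear_form (A - {a}) - linear_form l ^ card (A - {a}))"
    using finite_A by (simp add: deriv_Q sum_subtractf)
  then show ?thesis by (simp only:) (intro dvd_sum binary_prod_cong Diff_subset)
qed

text \<open>All derivatives are combinations of \<open>dir_deriv Q \<Phi>\<close> and
  \<open>\<theta>\<close>, so only \<open>g \<theta>\<close> has to be placed in \<open>J\<close>.
  Euler's relation gives this for \<open>b\<close>; since \<open>dir_deriv Q \<Phi>\<close> is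
  congruent to \<open>t l ^ (t - 1)\<close> modulo \<open>b\<close>, with \<open>t = card A\<close>
  invertible, it follows for \<open>l ^ (t - 1)\<close>.\<close>

lemma binary_in_residual:
  assumes g: "g \<in> ideal_gen {linear_form b, linear_form l ^ (card A - 1)}"
  shows "g * dir_deriv v \<Phi> \<in> J"
proof -
  let ?t = "of_nat (card A) :: 'k"
  have t: "?t \<noteq> 0" using l finite_A by auto
  have b\<theta>: "linear_form b * \<theta> \<in> J"
  proof -
    have "linear_form b * \<theta> = of_nat (card A) * \<Phi> - linear_form l * dir_deriv Q \<Phi>"
      using binary_euler by (simp add: eq_diff_eq)
    then show ?thesis by (simp only: ideal_gen_diff mult_form_prod_in_J mult_deriv_in_J)
  qed
  obtain r where r: "dir_deriv Q \<Phi> - of_nat (card A) * linear_form l ^ (card A - 1) = linear_form b * r"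
    using binary_deriv_cong ..
  have "\<theta> * dir_deriv Q \<Phi> - r * (linear_form b * \<theta>) =
      const_poly ?t * (linear_form l ^ (card A - 1) * \<theta>)"
  proof -
    have "dir_deriv Q \<Phi> = const_poly ?t * linear_form l ^ (card A - 1) + linear_form b * r"
      using r by (simp add: diff_eq_eq add.commute)
    then show ?thesis by (simp only:) (simp add: algebra_simps)
  qed
  moreover have "\<theta> * dir_deriv Q \<Phi> - r * (linear_form b * \<theta>) \<in> J"
    by (intro ideal_gen_diff mult_deriv_in_J ideal_gen_mult[OF b\<theta>])
  ultimately have "const_poly (inverse ?t) * (const_poly ?t * (linear_form l ^ (card A - 1) * \<theta>)) \<in> J"
    by (simp only: ideal_gen_mult)
  moreover have "const_poly (inverse ?t) * const_poly ?t = (1 :: ('k, 'n) polys)"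
    using t by (simp only: mult_single) simp
  ultimately have l\<theta>: "linear_form l ^ (card A - 1) * \<theta> \<in> J"
    by (simp only: mult.assoc[symmetric] mult_1_left)
  obtain p q where "g = p * linear_form b + q * linear_form l ^ (card A - 1)"
    using g by (auto simp: in_ideal_gen_two)
  then have "g * \<theta> = p * (linear_form b * \<theta>) + q * (linear_form l ^ (card A - 1) * \<theta>)"
    by (simp add: algebra_simps)
  then have "g * \<theta> \<in> J"
    by (simp only: ideal_gen_add ideal_gen_mult b\<theta> l\<theta>)
  moreover have "g * dir_deriv v \<Phi> =
      (g * const_poly (l \<odot> v)) * dir_deriv Q \<Phi> + const_poly (b \<odot> v) * (g * \<theta>)"
    by (simp add: binary_dir_deriv[of v] algebra_simps)
  ultimately show ?thesis
    by (simp only: ideal_gen_add ideal_gen_mult mult_deriv_in_J)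
qed

end

context
  fixes l b :: "'k ^ 'n"
  assumes l: "l \<in> A" and b: "b \<noteq> 0" "b \<odot> Q = 0"
begin

abbreviation "C \<equiv> pencil l b"
abbreviation "\<phi> \<equiv> prod linear_form (pencil l b)"
abbreviation "\<psi> \<equiv> prod linear_form (A - pencil l b)"

lemma normalized_pencil: "normalized_forms C Q"
  using pencil_subset finite_A normalized by unfold_locales (auto intro: finite_subset)

lemma pencil_split: "\<Phi> = \<phi> * \<psi>"
  using prod.subset_diff[OF pencil_subset finite_A] by (simp add: mult.commute)

lemma dir_deriv_split: "dir_deriv v \<Phi> = dir_deriv v \<phi> * \<psi> + \<phi> * dir_deriv v \<psi>"
  by (simp add: pencil_split dir_deriv_mult)

lemma pencil_coeff_ex: "\<exists>k. \<forall>a\<in>C. a = l + k a *s b"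
  unfolding pencil_def by (intro bchoice) auto

text \<open>The vectors \<open>x\<close> and \<open>Q\<close> are dual to \<open>b\<close> and
  \<open>l\<close>, so a form vanishing on \<open>b = l = 0\<close> is the combination of
  \<open>b\<close> and \<open>l\<close> with its values at \<open>x\<close> and \<open>Q\<close> as
  coefficients.\<close>

lemma in_pencil_iff:
  assumes "a \<in> A"
  shows "a \<in> C \<longleftrightarrow> (\<forall>v. b \<odot> v = 0 \<and> l \<odot> v = 0 \<longrightarrow> a \<odot> v = 0)"
proof
  assume "a \<in> C"
  then show "\<forall>v. b \<odot> v = 0 \<and> l \<odot> v = 0 \<longrightarrow> a \<odot> v = 0"
    by (auto simp: pencil_def scalar_product_simps)
next
  assume a: "\<forall>v. b \<odot> v = 0 \<and> l \<odot> v = 0 \<longrightarrow> a \<odot> v = 0"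
  obtain x where x: "b \<odot> x = 1" "l \<odot> x = 0" using dual_basis_ex b l normalized by blast
  have "a = l + (a \<odot> x) *s b"
  proof (rule scalar_product_eqI)
    fix v
    let ?w = "v - (b \<odot> v) *s x - (l \<odot> v) *s Q"
    have "b \<odot> ?w = 0" "l \<odot> ?w = 0"
      using x b l normalized by (simp_all add: scalar_product_simps)
    then have "a \<odot> ?w = 0" using a by blast
    then show "a \<odot> v = (l + (a \<odot> x) *s b) \<odot> v"
      using normalized[OF assms] by (simp add: scalar_product_simps algebra_simps)
  qed
  then show "a \<in> C" using assms by (auto simp: pencil_def)
qed

text \<open>Makes \<open>\<psi>\<close> an admissible multiplier in the unmixedness criterion: no
  member outside the pencil vanishes on all of \<open>b = l = 0\<close>.\<close>

lemma cofactor_nonvanishing: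
  "\<exists>v. b \<odot> v = 0 \<and> l \<odot> v = 0 \<and> poly_eval \<psi> v \<noteq> 0"
proof -
  have "\<exists>v\<in>{v. b \<odot> v = 0 \<and> l \<odot> v = 0}. poly_eval (linear_form a) v \<noteq> 0" if "a \<in> A - C" for a
    using that in_pencil_iff[of a] by auto
  then show ?thesis
    using subspace_nonvanishing_prod[OF subspace_zeros(2), of "A - C" b l linear_form] by blast
qed

text \<open>Cancelling \<open>\<psi>\<close> modulo \<open>\<phi>\<close> reduces the assertion to
  the pencil. There Euler's relation shows that \<open>\<phi>\<close> divides
  \<open>b q + g l\<close>; as \<open>\<phi>\<close> is \<open>l\<close> times a product congruent
  to \<open>l ^ (t - 1)\<close> modulo \<open>b\<close>, where \<open>t = card C\<close>, dividing
  by \<open>l\<close> gives the claim.\<close>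

lemma residual_local:
  assumes g: "\<And>v. g * dir_deriv v \<Phi> \<in> J"
  shows "g \<in> ideal_gen {linear_form b, linear_form l ^ (card C - 1)}"
proof -
  interpret C: normalized_forms C Q by (rule normalized_pencil)
  obtain k where k: "\<And>a. a \<in> C \<Longrightarrow> a = l + k a *s b" using pencil_coeff_ex by blast
  define \<theta> where "\<theta> = (\<Sum>a\<in>C. const_poly (k a) * prod linear_form (C - {a}))"
  define \<phi>' where "\<phi>' = dir_deriv Q \<phi>"
  note lC = self_in_pencil[OF l, of b]
  \<comment> \<open>In this direction the derivative of \<open>\<phi>\<close> is
    \<open>\<theta>\<close>.\<close>
  obtain v where v: "b \<odot> v = 1" "l \<odot> v = 0" using dual_basis_ex b l normalized by blast
  have "dir_deriv v \<phi> = const_poly (l \<odot> v) * dir_deriv Q \<phi> + const_poly (b \<odot> v) * \<theta>"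
    by (rule C.binary_dir_deriv[OF lC b k \<theta>_def])
  then have "dir_deriv v \<phi> = \<theta>"
    by (simp only: v single_zero single_one mult_zero_left mult_1_left add_0_left)
  moreover obtain p q where "g * dir_deriv v \<Phi> = p * \<Phi> + q * dir_deriv Q \<Phi>"
    using g in_J by blast
  ultimately have eq: "g * (\<theta> * \<psi> + \<phi> * dir_deriv v \<psi>) =
      p * (\<phi> * \<psi>) + q * (\<phi>' * \<psi> + \<phi> * dir_deriv Q \<psi>)"
    by (simp only: dir_deriv_split pencil_split[symmetric] \<phi>'_def)
  have "\<psi> * (q * \<phi>' - g * \<theta>) - \<phi> * (g * dir_deriv v \<psi> - p * \<psi> - q * dir_deriv Q \<psi>) =
     (p * (\<phi> * \<psi>) + q * (\<phi>' * \<psi> + \<phi> * dir_deriv Q \<psi>)) - g * (\<theta> * \<psi> + \<phi> * dir_deriv v \<psi>)"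
    by (simp add: algebra_simps)
  also have "\<dots> = 0" by (simp only: eq diff_self)
  finally have \<psi>: "\<psi> * (q * \<phi>' - g * \<theta>) = \<phi> * (g * dir_deriv v \<psi> - p * \<psi> - q * dir_deriv Q \<psi>)"
    by (rule right_minus_eq[THEN iffD1])
  have "\<phi> dvd q * \<phi>' - g * \<theta>"
  proof (rule C.prod_dvdI)
    fix a assume a: "a \<in> C"
    then have aA: "a \<in> A" using pencil_subset by auto
    have "linear_form a dvd \<psi> * (q * \<phi>' - g * \<theta>)"
      unfolding \<psi> using C.linear_form_dvd_form_prod[OF a] by (rule dvd_mult2)
    moreover have "\<not> linear_form a dvd \<psi>" using not_dvd_prod_remove[OF aA] a by auto
    ultimately show "linear_form a dvd q * \<phi>' - g * \<theta>"
      using linear_form_prime[OF nonzero[OF aA]] by blast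
  qed
  then obtain s where "q * \<phi>' - g * \<theta> = \<phi> * s" ..
  then have s: "q * \<phi>' = g * \<theta> + \<phi> * s" by (rule eq_add_if_diff_eq)
  \<comment> \<open>Multiplying the relation for \<open>q\<close> by \<open>b\<close> and adding
    \<open>g l \<phi>'\<close> produces the left-hand side of Euler's relation.\<close>
  have "(linear_form b * q + g * linear_form l) * \<phi>' =
      linear_form b * (q * \<phi>') + g * (linear_form l * \<phi>')"
    by (simp add: algebra_simps)
  also have "\<dots> = g * (linear_form b * \<theta> + linear_form l * \<phi>') + \<phi> * (linear_form b * s)"
    unfolding s by (simp add: algebra_simps)
  also have "linear_form b * \<theta> + linear_form l * \<phi>' = of_nat (card C) * \<phi>"
    unfolding \<phi>'_def by (rule C.binary_euler[OF lC b k \<theta>_def])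
  also have "g * (of_nat (card C) * \<phi>) + \<phi> * (linear_form b * s) =
      \<phi> * (g * of_nat (card C) + linear_form b * s)"
    by (simp add: algebra_simps)
  finally have "\<phi> dvd (linear_form b * q + g * linear_form l) * dir_deriv Q \<phi>"
    unfolding \<phi>'_def by (simp only: dvd_triv_left)
  then have "\<phi> dvd linear_form b * q + g * linear_form l" by (rule C.dvd_mult_deriv_Q)
  then obtain u where u: "linear_form b * q + g * linear_form l = \<phi> * u" ..
  let ?f = "prod linear_form (C - {l})"
  have "linear_form l * (g - ?f * u) = linear_form b * (- q)"
  proof -
    have "linear_form l * (g - ?f * u) - linear_form b * (- q) =
        (linear_form b * q + g * linear_form l) - \<phi> * u"
      by (simp add: C.prod_remove[OF lC] algebra_simps)
    then show ?thesis by (simp only: u diff_self right_minus_eq)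
  qed
  then have "linear_form b dvd linear_form l * (g - ?f * u)" by (simp only: dvd_triv_left)
  then have "linear_form b dvd g - ?f * u"
    using linear_form_prime[OF b(1)] not_dvd_normalized[OF b l] by blast
  moreover have "linear_form b dvd ?f - linear_form l ^ (card C - 1)"
    using C.binary_prod_cong[OF lC b k \<theta>_def, of "C - {l}"] C.finite_A lC by simp
  ultimately have "linear_form b dvd (g - ?f * u) + u * (?f - linear_form l ^ (card C - 1))"
    by simp
  then obtain r where "(g - ?f * u) + u * (?f - linear_form l ^ (card C - 1)) = linear_form b * r" ..
  moreover have "(g - ?f * u) + u * (?f - linear_form l ^ (card C - 1)) = g - u * linear_form l ^ (card C - 1)"
    by (simp add: algebra_simps)
  ultimately have "g = u * linear_form l ^ (card C - 1) + linear_form b * r"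
    by (intro eq_add_if_diff_eq) simp
  then have "g = r * linear_form b + u * linear_form l ^ (card C - 1)"
    by (simp add: ac_simps)
  then show ?thesis unfolding in_ideal_gen_two by blast
qed

text \<open>A converse of \<open>residual_local\<close> up to the factor \<open>\<psi>\<close>:
  after multiplication by \<open>\<psi>\<close> the relation for \<open>\<phi>\<close> lifts to
  \<open>\<Phi>\<close>, since every extra term is a multiple of \<open>\<Phi>\<close>.\<close>

lemma local_residual:
  assumes "g \<in> ideal_gen {linear_form b, linear_form l ^ (card C - 1)}"
  shows "\<psi> * (g * dir_deriv v \<Phi>) \<in> J"
proof -
  interpret C: normalized_forms C Q by (rule normalized_pencil)
  obtain k where k: "\<And>a. a \<in> C \<Longrightarrow> a = l + k a *s b" using pencil_coeff_ex by blast
  obtain p q where pq: "g * dir_deriv v \<phi> = p * \<phi> + q * dir_deriv Q \<phi>"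
    using C.binary_in_residual[OF self_in_pencil[OF l] b k refl assms, of v] in_ideal_gen_two by blast
  have "\<psi> * (g * dir_deriv v \<Phi>) = \<psi> * \<psi> * (g * dir_deriv v \<phi>) + g * dir_deriv v \<psi> * \<Phi>"
    unfolding dir_deriv_split unfolding pencil_split by (simp add: algebra_simps)
  also have "\<dots> = (p * \<psi> + g * dir_deriv v \<psi> - q * dir_deriv Q \<psi>) * \<Phi> + (q * \<psi>) * dir_deriv Q \<Phi>"
    unfolding pq dir_deriv_split unfolding pencil_split by (simp add: algebra_simps)
  finally show ?thesis unfolding in_J by blast
qed

end

text \<open>From right to left, the discriminant product maps each derivative into \<open>J\<close>.
  Its factors are nonzero and vanish at \<open>Q\<close>, so they can be removed by unmixedness,
  with the cofactors of the pencils as multipliers. A pencil consisting of \<open>l\<close> alone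
  has exponent 0 and imposes no condition.\<close>

theorem residual_iff:
  "(\<forall>v. g * dir_deriv v \<Phi> \<in> J) \<longleftrightarrow>
   (\<forall>l\<in>A. \<forall>b. b \<noteq> 0 \<and> b \<odot> Q = 0 \<longrightarrow>
      g \<in> ideal_gen {linear_form b, linear_form l ^ (card (pencil l b) - 1)})"
proof (intro iffI allI ballI impI)
  fix v
  assume g: "\<forall>l\<in>A. \<forall>b. b \<noteq> 0 \<and> b \<odot> Q = 0 \<longrightarrow>
      g \<in> ideal_gen {linear_form b, linear_form l ^ (card (pencil l b) - 1)}"
  show "g * dir_deriv v \<Phi> \<in> J"
  proof (rule J_unmixed_prod[of "SIGMA a:A. A - {a}" "\<lambda>(a, c). c - a"])
    show "finite (SIGMA a:A. A - {a})" using finite_A by simp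
    have "g * ((\<Prod>(a, c)\<in>(SIGMA a:A. A - {a}). linear_form (c - a)) * dir_deriv v \<Phi>) \<in> J"
      by (intro ideal_gen_mult discriminant_mult_deriv_in_J)
    then show "(\<Prod>i\<in>(SIGMA a:A. A - {a}). linear_form (case i of (a, c) \<Rightarrow> c - a)) *
        (g * dir_deriv v \<Phi>) \<in> J"
      by (simp only: mult.left_commute[of g] case_prod_unfold)
  next
    fix i assume "i \<in> (SIGMA a:A. A - {a})"
    then show i: "(case i of (a, c) \<Rightarrow> c - a) \<noteq> 0 \<and> (case i of (a, c) \<Rightarrow> c - a) \<odot> Q = 0"
      by (auto simp: scalar_product_simps normalized)
    fix l assume "l \<in> A"
    then show "\<exists>m. (\<exists>v. (case i of (a, c) \<Rightarrow> c - a) \<odot> v = 0 \<and> l \<odot> v = 0 \<and> poly_eval m v \<noteq> 0) \<and>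
        m * (g * dir_deriv v \<Phi>) \<in> J"
      using i g cofactor_nonvanishing local_residual by blast
  qed
qed (blast intro: residual_local)

end

subsection \<open>Hyperplanes and subspaces of codimension two\<close>

lemma dim_insert_subspace:
  fixes W :: "('k::field ^ 'n::finite) set"
  assumes "vec.subspace W" "x \<notin> W"
  shows "vec.dim (insert x W) = vec.dim W + 1"
  using assms by (metis vec.dim_insert vec.span_eq_iff Suc_eq_plus1)

lemma span_eq_UNIV_iff:
  fixes S :: "('k::field ^ 'n::finite) set"
  shows "vec.span S = UNIV \<longleftrightarrow> vec.dim S = CARD('n)"
  using vec.dim_eq_full[of S] by (simp add: vec.dimension_def card_cart_basis)

lemma functional_ex:
  fixes W :: "('k::field ^ 'n::finite) set"
  assumes "vec.subspace W" "x \<notin> W"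
  shows "\<exists>a. (\<forall>w\<in>W. a \<odot> w = 0) \<and> a \<odot> x = 1"
proof -
  obtain B where B: "B \<subseteq> W" "vec.independent B" "W \<subseteq> vec.span B"
    using vec.basis_exists by metis
  then have span: "vec.span B = W"
    using assms(1) vec.span_minimal by blast
  then have "vec.independent (insert x B)"
    using B assms(2) by (simp add: vec.independent_insertI)
  then obtain g where g: "Vector_Spaces.linear (*s) (*s) g"
    "\<forall>y\<in>insert x B. g y = (if y = x then 1 else (0 :: 'k ^ 'n))"
    using vec.linear_independent_extend[of "insert x B" "\<lambda>y. if y = x then 1 else 0"] by blast
  have gB: "g y = 0" if "y \<in> B" for y
    using g(2) that B(1) assms(2) by auto
  \<comment> \<open>Any coordinate of \<open>g\<close> serves as the functional, since
    \<open>g\<close> maps \<open>x\<close> to the all-ones vector.\<close>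
  define i :: 'n where "i = undefined"
  have eq: "matrix g $ i \<odot> v = g v $ i" for v
    using matrix_works[OF g(1), of v]
    by (simp add: scalar_product_def matrix_vector_mult_def vec_eq_iff)
  have "vec.subspace {v. matrix g $ i \<odot> v = 0}" by (rule subspace_zeros)
  then have "vec.span B \<subseteq> {v. matrix g $ i \<odot> v = 0}"
    by (intro vec.span_minimal) (auto simp: eq gB)
  moreover have "matrix g $ i \<odot> x = 1" using g(2) by (simp add: eq)
  ultimately show ?thesis unfolding span by blast
qed

lemma hyperplane_normal_ex:
  fixes H :: "('k::field ^ 'n::finite) set"
  assumes "hyperplane H" "Q \<notin> H"
  shows "\<exists>a. a \<odot> Q = 1 \<and> H = {v. a \<odot> v = 0}"
proof -
  have H: "vec.subspace H" "vec.dim H + 1 = CARD('n)"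
    using assms(1) by (auto simp: linear_subspace_codim_def)
  obtain a where a: "\<forall>w\<in>H. a \<odot> w = 0" "a \<odot> Q = 1" using functional_ex[OF H(1) assms(2)] by blast
  have "vec.dim (insert Q H) = CARD('n)"
    using H(2) dim_insert_subspace[OF H(1) assms(2)] by simp
  then have "vec.span (insert Q H) = UNIV"
    by (simp only: span_eq_UNIV_iff)
  moreover have "vec.span H = H" using H(1) by simp
  ultimately have "v \<in> H" if "a \<odot> v = 0" for v
  proof -
    obtain k where k: "v - k *s Q \<in> H"
      using \<open>vec.span (insert Q H) = UNIV\<close> \<open>vec.span H = H\<close> vec.span_breakdown_eq by blast
    then have "a \<odot> (v - k *s Q) = 0" using a by blast
    then have "k = 0" using that a by (simp add: scalar_product_simps)
    then show ?thesis using k by simp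
  qed
  then show ?thesis using a by auto
qed

text \<open>Adjoining first \<open>y\<close> and then \<open>x\<close> to the common zeros fills the
  whole space, and each adjunction raises the dimension by one.\<close>

lemma codim_zeros:
  fixes a b :: "'k::field ^ 'n::finite"
  assumes "b \<odot> x = 1" "b \<odot> y = 0" "a \<odot> x = 0" "a \<odot> y = 1"
  shows span_insert_zeros: "vec.span (insert y {v. b \<odot> v = 0 \<and> a \<odot> v = 0}) = {v. b \<odot> v = 0}"
    and hyperplane_zeros: "hyperplane {v. b \<odot> v = 0}"
    and codim2_zeros: "linear_subspace_codim 2 {v. b \<odot> v = 0 \<and> a \<odot> v = 0}"
proof -
  let ?P = "{v. b \<odot> v = 0 \<and> a \<odot> v = 0}" and ?H = "{v. b \<odot> v = 0}"
  have P: "vec.span ?P = ?P" and H: "vec.span ?H = ?H"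
    using subspace_zeros(1)[of b] subspace_zeros(2)[of b a] by simp_all
  show span1: "vec.span (insert y ?P) = ?H"
  proof
    show "?H \<subseteq> vec.span (insert y ?P)"
    proof
      fix v assume "v \<in> ?H"
      then have "v - (a \<odot> v) *s y \<in> vec.span ?P"
        using assms by (simp add: P scalar_product_simps)
      then show "v \<in> vec.span (insert y ?P)" unfolding vec.span_breakdown_eq by blast
    qed
  qed (rule vec.span_minimal[OF _ subspace_zeros(1)], use assms in auto)
  have "v \<in> vec.span (insert x ?H)" for v
  proof -
    have "v - (b \<odot> v) *s x \<in> vec.span ?H" using assms by (simp add: H scalar_product_simps)
    then show ?thesis unfolding vec.span_breakdown_eq by blast
  qed
  then have "vec.span (insert x ?H) = UNIV" by blast
  then have "vec.dim (insert x ?H) = CARD('n)" by (simp only: span_eq_UNIV_iff)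
  then have dimH: "vec.dim ?H + 1 = CARD('n)"
    using assms dim_insert_subspace[OF subspace_zeros(1)[of b], of x] by simp
  then show "hyperplane ?H" using subspace_zeros by (simp add: linear_subspace_codim_def)
  have "vec.dim ?H = vec.dim (insert y ?P)" unfolding span1[symmetric] by (rule vec.dim_span)
  then have "vec.dim ?P + 1 = vec.dim ?H"
    using assms dim_insert_subspace[OF subspace_zeros(2)[of b a], of y] by simp
  then show "linear_subspace_codim 2 ?P"
    using dimH subspace_zeros by (simp add: linear_subspace_codim_def)
qed

lemma linear_subspace_codim_eqI:
  assumes "linear_subspace_codim c V" "linear_subspace_codim c W" "V \<subseteq> W"
  shows "V = W"
  using assms by (intro vec.subspace_dim_equal) (auto simp: linear_subspace_codim_def)

lemma linear_subspace_codim_not_subset: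
  assumes "linear_subspace_codim c V" "linear_subspace_codim d W" "c < d"
  shows "\<not> V \<subseteq> W"
  using assms vec.dim_subset[of V W] by (auto simp: linear_subspace_codim_def)

lemma hyperplane_form_eq:
  fixes H :: "('k::field ^ 'n::finite) set"
  assumes "hyperplane H"
  obtains a where "a \<noteq> 0" "hyperplane_form H = linear_form a" "H = {v. a \<odot> v = 0}"
proof -
  have "H \<noteq> UNIV"
    using assms by (auto simp: linear_subspace_codim_def vec.dimension_def card_cart_basis)
  then obtain Q where "Q \<notin> H" by blast
  define a where "a = (SOME a. {v. poly_eval (linear_form a) v = 0} = H)"
  have "\<exists>a. {v. poly_eval (linear_form a) v = 0} = H"
    using hyperplane_normal_ex[OF assms \<open>Q \<notin> H\<close>] by auto
  then have H: "{v. poly_eval (linear_form a) v = 0} = H"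
    unfolding a_def by (rule someI_ex)
  then have "a \<noteq> 0" using \<open>H \<noteq> UNIV\<close> by auto
  with H show ?thesis by (intro that[of a]) (auto simp: hyperplane_form_def a_def)
qed

lemma inter_hyperplanes_codim2:
  fixes H H' :: "('k::field ^ 'n::finite) set"
  assumes "hyperplane H" "hyperplane H'" "H \<noteq> H'"
  shows "linear_subspace_codim 2 (H \<inter> H')"
proof -
  obtain x y where xy: "x \<in> H'" "x \<notin> H" "y \<in> H" "y \<notin> H'"
    using assms linear_subspace_codim_eqI by blast
  obtain a b where "a \<odot> x = 1" "H = {v. a \<odot> v = 0}" "b \<odot> y = 1" "H' = {v. b \<odot> v = 0}"
    using hyperplane_normal_ex[OF assms(1) xy(2)] hyperplane_normal_ex[OF assms(2) xy(4)] by blast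
  then show ?thesis using codim2_zeros[of a x y b] xy by (simp add: Int_def)
qed

text \<open>Coordinates adapted to \<open>P\<close> and \<open>Q\<close>: \<open>b\<close> is an
  equation of the hyperplane spanned by both, \<open>l\<close> is an equation of \<open>P\<close>
  normalized at \<open>Q\<close>, and \<open>x\<close>, \<open>Q\<close> are dual to them.\<close>

lemma codim2_dual_ex:
  fixes P :: "('k::field ^ 'n::finite) set"
  assumes "linear_subspace_codim 2 P" "Q \<notin> P"
  obtains b l x where "b \<odot> x = 1" "b \<odot> Q = 0" "l \<odot> x = 0" "l \<odot> Q = 1"
    "P = {v. b \<odot> v = 0 \<and> l \<odot> v = 0}"
proof -
  have P: "vec.subspace P" "vec.dim P + 2 = CARD('n)"
    using assms(1) by (auto simp: linear_subspace_codim_def)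
  then have dim: "vec.dim (insert Q P) + 1 = CARD('n)"
    using dim_insert_subspace[OF P(1) assms(2)] by simp
  then have H: "hyperplane (vec.span (insert Q P))" by (simp add: linear_subspace_codim_def)
  have "vec.span (insert Q P) \<noteq> UNIV"
    using dim by (simp add: span_eq_UNIV_iff)
  then obtain y where y: "y \<notin> vec.span (insert Q P)" by blast
  obtain b where b: "b \<odot> y = 1" "vec.span (insert Q P) = {v. b \<odot> v = 0}"
    using hyperplane_normal_ex[OF H y] by blast
  obtain l where l: "\<forall>v\<in>P. l \<odot> v = 0" "l \<odot> Q = 1"
    using functional_ex[OF P(1) assms(2)] by blast
  have bQ: "b \<odot> Q = 0" and bP: "\<And>v. v \<in> P \<Longrightarrow> b \<odot> v = 0"
    using b(2) vec.span_base[of _ "insert Q P"] by auto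
  define x where "x = y - (l \<odot> y) *s Q"
  have dual: "b \<odot> x = 1" "l \<odot> x = 0"
    using b l bQ by (simp_all add: x_def scalar_product_simps)
  have "P = {v. b \<odot> v = 0 \<and> l \<odot> v = 0}"
    by (rule linear_subspace_codim_eqI[OF assms(1) codim2_zeros[OF dual(1) bQ dual(2) l(2)]])
      (use l bP in auto)
  then show ?thesis using that dual bQ l(2) by blast
qed


subsection \<open>The ideals attached to subspaces of codimension two\<close>

lemma homogeneous_linear_form: "homogeneous (linear_form a)"
proof -
  have "\<exists>i. m = Poly_Mapping.single i 1" if "m \<in> Poly_Mapping.keys (linear_form a)" for m
  proof (rule ccontr)
    assume "\<nexists>i. m = Poly_Mapping.single i 1"
    then have "Poly_Mapping.lookup (linear_form a) m = 0"
      by (auto simp: linear_form_def lookup_sum lookup_single when_def intro!: sum.neutral)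
    then show False using that by (simp add: in_keys_iff)
  qed
  then show ?thesis
    unfolding homogeneous_def by (intro exI[of _ 1]) (force simp: lookup_single when_def)
qed

definition component_ideal ::
    "'k ^ 'n \<Rightarrow> ('k::field ^ 'n::finite) set \<Rightarrow> nat \<Rightarrow> ('k, 'n) polys set" where
  "component_ideal Q P e =
     ideal_gen (insert (hyperplane_form (vec.span (insert Q P))) (ideal_power (homogeneous_ideal P) e))"

lemma residual_like_ideal_eq:
  "residual_like_ideal Y E Q = (\<Inter>P\<in>Y. component_ideal Q P (E P))"
  by (simp add: residual_like_ideal_def component_ideal_def)

text \<open>Modulo \<open>b\<close> the ideal of \<open>P\<close> is generated by \<open>l\<close>,
  hence its power by \<open>l ^ e\<close>. The form selected by \<open>hyperplane_form\<close> may
  differ from \<open>b\<close>, but each divides the other.\<close>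

lemma component_ideal_eq:
  fixes b l x Q :: "'k::field_char_0 ^ 'n::finite"
  assumes dual: "b \<odot> x = 1" "b \<odot> Q = 0" "l \<odot> x = 0" "l \<odot> Q = 1"
    and P: "P = {v. b \<odot> v = 0 \<and> l \<odot> v = 0}"
  shows "component_ideal Q P e = ideal_gen {linear_form b, linear_form l ^ e}"
proof -
  have b: "b \<noteq> 0" using dual by auto
  have hom: "homogeneous_ideal P = ideal_gen {linear_form b, linear_form l}"
  proof
    have "F \<in> ideal_gen {linear_form b, linear_form l}" if "\<forall>v\<in>P. poly_eval F v = 0" for F
    proof -
      have "poly_eval F v = 0" if "b \<odot> v = 0" "l \<odot> v = 0" for v
        using that \<open>\<forall>v\<in>P. poly_eval F v = 0\<close> P by blast
      then obtain X Y where "F = linear_form b * X + linear_form l * Y"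
        using vanishing_two_linear_forms[OF dual] by blast
      then show ?thesis unfolding in_ideal_gen_two by (metis mult.commute)
    qed
    then show "homogeneous_ideal P \<subseteq> ideal_gen {linear_form b, linear_form l}"
      unfolding homogeneous_ideal_def by (intro ideal_gen_subsetI) blast
    show "ideal_gen {linear_form b, linear_form l} \<subseteq> homogeneous_ideal P"
      unfolding homogeneous_ideal_def using P
      by (intro ideal_gen_subsetI) (auto intro!: ideal_gen_base simp: homogeneous_linear_form)
  qed
  have span: "vec.span (insert Q P) = {v. b \<odot> v = 0}"
    unfolding P by (rule span_insert_zeros[OF dual])
  obtain b' where b': "b' \<noteq> 0" "hyperplane_form (vec.span (insert Q P)) = linear_form b'"
    "{v. b \<odot> v = 0} = {v. b' \<odot> v = 0}"
    using hyperplane_form_eq[of "vec.span (insert Q P)"] hyperplane_zeros[OF dual] span by metis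
  have bb': "linear_form b dvd linear_form b'" "linear_form b' dvd linear_form b"
    using linear_form_dvd_iff[OF b, of "linear_form b'"] linear_form_dvd_iff[OF b'(1), of "linear_form b"]
      b'(3) by auto
  let ?I = "ideal_gen {linear_form b, linear_form l ^ e}"
  have "(\<Prod>j<e. a j) \<in> ?I" if a: "\<forall>j<e. a j \<in> homogeneous_ideal P" for a
  proof -
    have "\<exists>q. \<forall>j<e. \<exists>p. a j = p * linear_form b + q j * linear_form l"
      using a unfolding hom in_ideal_gen_two by metis
    then obtain q where q: "\<forall>j<e. \<exists>p. a j = p * linear_form b + q j * linear_form l" ..
    have "linear_form b dvd (\<Prod>j<e. a j) - (\<Prod>j<e. q j) * linear_form l ^ e"
    proof (subst linear_form_dvd_iff[OF b], intro allI impI)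
      fix v assume v: "b \<odot> v = 0"
      have "poly_eval (a j) v = poly_eval (q j) v * (l \<odot> v)" if "j < e" for j
        using q that v by fastforce
      then show "poly_eval ((\<Prod>j<e. a j) - (\<Prod>j<e. q j) * linear_form l ^ e) v = 0"
        by (simp add: prod.distrib)
    qed
    then obtain r where "(\<Prod>j<e. a j) - (\<Prod>j<e. q j) * linear_form l ^ e = linear_form b * r" ..
    then have "(\<Prod>j<e. a j) = (\<Prod>j<e. q j) * linear_form l ^ e + linear_form b * r"
      by (rule eq_add_if_diff_eq)
    then show ?thesis unfolding in_ideal_gen_two by (metis add.commute mult.commute)
  qed
  then have "ideal_power (homogeneous_ideal P) e \<subseteq> ?I"
    unfolding ideal_power_def by (intro ideal_gen_subsetI) blast
  moreover have "linear_form b' \<in> ?I"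
    using bb'(1) ideal_gen_mult[OF ideal_gen_base[of "linear_form b" "{linear_form b, linear_form l ^ e}"]]
    by (auto elim!: dvdE simp: mult.commute)
  ultimately have "component_ideal Q P e \<subseteq> ?I"
    unfolding component_ideal_def b'(2) by (intro ideal_gen_subsetI) blast
  moreover have "?I \<subseteq> component_ideal Q P e"
  proof -
    let ?B = "insert (linear_form b') (ideal_power (homogeneous_ideal P) e)"
    have "linear_form l \<in> homogeneous_ideal P" unfolding hom by (intro ideal_gen_base) simp
    then have "(\<Prod>j<e. linear_form l) \<in> ideal_power (homogeneous_ideal P) e"
      unfolding ideal_power_def by (intro ideal_gen_base) blast
    then have "linear_form l ^ e \<in> ideal_gen ?B" by (intro ideal_gen_base) simp
    moreover have "linear_form b \<in> ideal_gen ?B"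
      using bb'(2) ideal_gen_mult[OF ideal_gen_base[of "linear_form b'" ?B]]
      by (auto elim!: dvdE simp: mult.commute)
    ultimately show ?thesis
      unfolding component_ideal_def b'(2) by (intro ideal_gen_subsetI) blast
  qed
  ultimately show ?thesis by blast
qed

lemma component_ideal_nonvanishing:
  fixes P :: "('k::field_char_0 ^ 'n::finite) set"
  assumes "linear_subspace_codim 2 P" "Q \<notin> P" "\<not> W \<subseteq> P"
  shows "\<exists>h\<in>component_ideal Q P e. \<exists>v\<in>W. poly_eval h v \<noteq> 0"
proof -
  obtain b l x where dual: "b \<odot> x = 1" "b \<odot> Q = 0" "l \<odot> x = 0" "l \<odot> Q = 1"
    and P: "P = {v. b \<odot> v = 0 \<and> l \<odot> v = 0}"
    by (rule codim2_dual_ex[OF assms(1,2)])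
  obtain w where "w \<in> W" "b \<odot> w \<noteq> 0 \<or> l \<odot> w \<noteq> 0" using assms(3) P by blast
  then have "poly_eval (linear_form b) w \<noteq> 0 \<or> poly_eval (linear_form l ^ e) w \<noteq> 0" by auto
  moreover have "linear_form b \<in> component_ideal Q P e" "linear_form l ^ e \<in> component_ideal Q P e"
    unfolding component_ideal_eq[OF dual P] by (auto intro: ideal_gen_base)
  ultimately show ?thesis using \<open>w \<in> W\<close> by blast
qed

lemma component_ideal_mult: "h \<in> component_ideal Q P e \<Longrightarrow> c * h \<in> component_ideal Q P e"
  unfolding component_ideal_def by (rule ideal_gen_mult)

lemma prod_in_component_ideal:
  assumes "finite Y" "P \<in> Y" "h P \<in> component_ideal Q P e"
  shows "prod h Y \<in> component_ideal Q P e"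
  using component_ideal_mult[OF assms(3), of "prod h (Y - {P})"]
  by (simp add: prod.remove[OF assms(1,2)] mult.commute)

text \<open>Choose from each component an element that is nonzero somewhere on \<open>W\<close>;
  their product lies in all components, and \<open>W\<close> is irreducible.\<close>

lemma residual_like_ideal_nonvanishing:
  fixes Y :: "('k::field_char_0 ^ 'n::finite) set set"
  assumes "finite Y" "\<And>P. P \<in> Y \<Longrightarrow> linear_subspace_codim 2 P \<and> Q \<notin> P \<and> \<not> W \<subseteq> P"
    and "vec.subspace W"
  shows "\<exists>h\<in>residual_like_ideal Y E Q. \<exists>v\<in>W. poly_eval h v \<noteq> 0"
proof -
  have "\<forall>P\<in>Y. \<exists>h. h \<in> component_ideal Q P (E P) \<and> (\<exists>v\<in>W. poly_eval h v \<noteq> 0)"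
  proof
    fix P assume "P \<in> Y"
    then show "\<exists>h. h \<in> component_ideal Q P (E P) \<and> (\<exists>v\<in>W. poly_eval h v \<noteq> 0)"
      using component_ideal_nonvanishing[of P Q W "E P"] assms(2)[of P] by blast
  qed
  then obtain h where h: "\<forall>P\<in>Y. h P \<in> component_ideal Q P (E P) \<and> (\<exists>v\<in>W. poly_eval (h P) v \<noteq> 0)"
    by (rule bchoice[THEN exE])
  have "prod h Y \<in> residual_like_ideal Y E Q"
    unfolding residual_like_ideal_eq using h prod_in_component_ideal[OF assms(1)] by blast
  moreover have "\<exists>v\<in>W. poly_eval (prod h Y) v \<noteq> 0"
    by (rule subspace_nonvanishing_prod[OF assms(3)]) (use h in blast)
  ultimately show ?thesis by blast
qed

text \<open>Take \<open>h\<close> in all components other than that of \<open>P\<close>, not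
  identically zero on \<open>P\<close>. Then \<open>l ^ s h\<close> lies in the ideal, where
  \<open>s\<close> is the exponent of \<open>P\<close> in it; were \<open>s < e\<close>, cancelling
  \<open>l ^ s\<close> modulo \<open>b\<close> would force \<open>h\<close> to vanish on
  \<open>P\<close>.\<close>

lemma residual_like_ideal_subset_component:
  fixes Y :: "('k::field_char_0 ^ 'n::finite) set set"
  assumes "finite Y" and Y: "\<And>P. P \<in> Y \<Longrightarrow> linear_subspace_codim 2 P \<and> Q \<notin> P"
    and P: "linear_subspace_codim 2 P" "Q \<notin> P" and "e > 0"
    and sub: "residual_like_ideal Y E Q \<subseteq> component_ideal Q P e"
  shows "P \<in> Y \<and> e \<le> E P"
proof (rule ccontr)
  assume neg: "\<not> ?thesis"
  \<comment> \<open>A subspace outside \<open>Y\<close> counts with exponent 0, which treats both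
    ways of violating the claim at once.\<close>
  define s where "s = (if P \<in> Y then E P else 0)"
  have "s < e" using neg \<open>e > 0\<close> by (auto simp: s_def)
  obtain b l x where dual: "b \<odot> x = 1" "b \<odot> Q = 0" "l \<odot> x = 0" "l \<odot> Q = 1"
    and Peq: "P = {v. b \<odot> v = 0 \<and> l \<odot> v = 0}"
    by (rule codim2_dual_ex[OF P])
  have b: "b \<noteq> 0" using dual by auto
  obtain h v where h: "h \<in> residual_like_ideal (Y - {P}) E Q" "v \<in> P" "poly_eval h v \<noteq> 0"
  proof -
    have "vec.subspace P" using P(1) by (simp add: linear_subspace_codim_def)
    moreover have "\<not> P \<subseteq> P'" if "P' \<in> Y - {P}" for P'
      using that linear_subspace_codim_eqI[OF P(1), of P'] Y by blast
    ultimately have "\<exists>h\<in>residual_like_ideal (Y - {P}) E Q. \<exists>v\<in>P. poly_eval h v \<noteq> 0"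
      using assms(1) Y by (intro residual_like_ideal_nonvanishing) auto
    then show ?thesis using that by blast
  qed
  let ?g = "linear_form l ^ s * h"
  have "?g \<in> component_ideal Q P' (E P')" if "P' \<in> Y" for P'
  proof (cases "P' = P")
    case True
    then have "linear_form l ^ s \<in> component_ideal Q P' (E P')"
      using that unfolding True component_ideal_eq[OF dual Peq] s_def by (auto intro: ideal_gen_base)
    then have "h * linear_form l ^ s \<in> component_ideal Q P' (E P')" by (rule component_ideal_mult)
    then show ?thesis by (simp only: mult.commute)
  next
    case False
    then show ?thesis using h(1) that by (auto simp: residual_like_ideal_eq intro: component_ideal_mult)
  qed
  then have "?g \<in> component_ideal Q P e"
    using sub by (auto simp: residual_like_ideal_eq)
  then obtain p q where pq: "?g = p * linear_form b + q * linear_form l ^ e"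
    unfolding component_ideal_eq[OF dual Peq] in_ideal_gen_two by blast
  have "linear_form l ^ e = linear_form l ^ s * linear_form l ^ (e - s)"
    using \<open>s < e\<close> by (simp flip: power_add)
  then have "linear_form l ^ s * (h - q * linear_form l ^ (e - s)) = ?g - q * linear_form l ^ e"
    by (simp add: algebra_simps)
  also have "\<dots> = linear_form b * p" unfolding pq by (simp add: mult.commute)
  finally have "linear_form b dvd linear_form l ^ s * (h - q * linear_form l ^ (e - s))"
    by (simp only: dvd_triv_left)
  moreover have "\<not> linear_form b dvd linear_form l ^ s"
  proof
    assume "linear_form b dvd linear_form l ^ s"
    then have "poly_eval (linear_form l ^ s) Q = 0"
      using dual(2) linear_form_dvd_iff[OF b] by blast
    then show False using dual(4) by simp
  qed
  ultimately have "linear_form b dvd h - q * linear_form l ^ (e - s)"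
    using linear_form_prime[OF b] by blast
  then have "poly_eval (h - q * linear_form l ^ (e - s)) v = 0"
    using linear_form_dvd_iff[OF b] h(2) Peq by blast
  then show False using h(2,3) Peq \<open>s < e\<close> by simp
qed

text \<open>Each component of either side contains the common ideal, so the preceding criterion
  applies in both directions. Positive exponents make every component visible.\<close>

lemma residual_like_ideal_inject:
  fixes Y Y' :: "('k::field_char_0 ^ 'n::finite) set set"
  assumes "finite Y" "\<And>P. P \<in> Y \<Longrightarrow> linear_subspace_codim 2 P \<and> Q \<notin> P \<and> E P > 0"
    and "finite Y'" "\<And>P. P \<in> Y' \<Longrightarrow> linear_subspace_codim 2 P \<and> Q \<notin> P \<and> E' P > 0"
    and eq: "residual_like_ideal Y E Q = residual_like_ideal Y' E' Q"
  shows "Y = Y' \<and> (\<forall>P\<in>Y. E P = E' P)"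
proof -
  have 1: "P \<in> Y \<and> E' P \<le> E P" if "P \<in> Y'" for P
  proof (rule residual_like_ideal_subset_component[OF assms(1)])
    show "residual_like_ideal Y E Q \<subseteq> component_ideal Q P (E' P)"
      using that unfolding eq by (auto simp: residual_like_ideal_eq)
  qed (use that assms in auto)
  have 2: "P \<in> Y' \<and> E P \<le> E' P" if "P \<in> Y" for P
  proof (rule residual_like_ideal_subset_component[OF assms(3)])
    show "residual_like_ideal Y' E' Q \<subseteq> component_ideal Q P (E P)"
      using that unfolding eq[symmetric] by (auto simp: residual_like_ideal_eq)
  qed (use that assms in auto)
  show ?thesis using 1 2 by (auto intro: le_antisym)
qed

subsection \<open>The residual of an arrangement\<close>

text \<open>A nonzero scalar changes neither ideal. The partial derivatives are the derivatives in
  coordinate directions, and every directional derivative is a combination of them.\<close>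

lemma colon_Jac_iff:
  fixes F g :: "('k::field, 'n::finite) polys"
  assumes f: "f = const_poly c * F" and "c \<noteq> 0"
  shows "g \<in> ideal_colon (ideal_gen {f, dir_deriv Q f}) (Jac f) \<longleftrightarrow>
    (\<forall>v. g * dir_deriv v F \<in> ideal_gen {F, dir_deriv Q F})"
proof -
  let ?J = "ideal_gen {F, dir_deriv Q F}" and ?c = "const_poly c :: ('k, 'n) polys"
  have inv: "const_poly (inverse c) * (?c * h) = h" for h :: "('k, 'n) polys"
    using assms(2) by (simp add: mult_single flip: mult.assoc)
  have D: "dir_deriv v f = ?c * dir_deriv v F" for v
    by (simp add: f dir_deriv_mult)
  have unit: "?c * h \<in> ?J \<longleftrightarrow> h \<in> ?J" for h
    using ideal_gen_mult[of "?c * h" _ "const_poly (inverse c)"] ideal_gen_mult[of h _ ?c]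
    unfolding inv by blast
  have J: "ideal_gen {f, dir_deriv Q f} = ?J"
  proof
    show "ideal_gen {f, dir_deriv Q f} \<subseteq> ?J"
      unfolding D unfolding f by (intro ideal_gen_subsetI) (auto simp: unit intro: ideal_gen_base)
    have "const_poly (inverse c) * f \<in> ideal_gen {f, dir_deriv Q f}"
      "const_poly (inverse c) * dir_deriv Q f \<in> ideal_gen {f, dir_deriv Q f}"
      by (rule ideal_gen_mult, rule ideal_gen_base, simp)+
    then have "F \<in> ideal_gen {f, dir_deriv Q f}" "dir_deriv Q F \<in> ideal_gen {f, dir_deriv Q f}"
      by (simp_all only: D inv) (simp_all only: f inv)
    then show "?J \<subseteq> ideal_gen {f, dir_deriv Q f}" by (intro ideal_gen_subsetI) blast
  qed
  have D_Jac: "dir_deriv v f \<in> Jac f" for v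
    unfolding Jac_def dir_deriv_eq
    by (rule ideal_gen_sum[OF ideal_gen_mult[OF ideal_gen_base]]) blast
  show ?thesis
  proof
    assume g: "g \<in> ideal_colon (ideal_gen {f, dir_deriv Q f}) (Jac f)"
    show "\<forall>v. g * dir_deriv v F \<in> ?J"
    proof
      fix v
      have "g * dir_deriv v f \<in> ?J" using g D_Jac J by (auto simp: ideal_colon_def)
      then have "?c * (g * dir_deriv v F) \<in> ?J" by (simp only: D mult.left_commute)
      then show "g * dir_deriv v F \<in> ?J" by (simp only: unit)
    qed
  next
    assume g: "\<forall>v. g * dir_deriv v F \<in> ?J"
    have "g * h \<in> ?J" if "h \<in> Jac f" for h
      using that unfolding Jac_def ideal_gen_def[of "range _"]
    proof (induction rule: module.span_induct_alt[OF module_mult, consumes 1, case_names base step])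
      case base
      show ?case by (simp add: ideal_gen_0)
    next
      case (step r h h')
      then obtain i where "h = partial i f" by blast
      then have "h = ?c * dir_deriv (axis i 1) F" by (simp add: D flip: dir_deriv_axis)
      then have "g * (r * h) = r * (?c * (g * dir_deriv (axis i 1) F))" by (simp add: ac_simps)
      then have "g * (r * h) \<in> ?J" using g by (simp only: ideal_gen_mult)
      then show ?case unfolding distrib_left using step.IH by (rule ideal_gen_add)
    qed
    then show "g \<in> ideal_colon (ideal_gen {f, dir_deriv Q f}) (Jac f)"
      unfolding J ideal_colon_def by blast
  qed
qed

definition unit_normal :: "'k ^ 'n \<Rightarrow> ('k::field ^ 'n::finite) set \<Rightarrow> 'k ^ 'n" where
  "unit_normal Q H = (SOME a. a \<odot> Q = 1 \<and> H = {v. a \<odot> v = 0})"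

lemma unit_normal:
  fixes H :: "('k::field ^ 'n::finite) set"
  assumes "hyperplane H" "Q \<notin> H"
  shows "unit_normal Q H \<odot> Q = 1" "H = {v. unit_normal Q H \<odot> v = 0}"
  using someI_ex[OF hyperplane_normal_ex[OF assms]] by (auto simp: unit_normal_def)

text \<open>The scalar is the value at \<open>Q\<close> of the form chosen for
  \<open>H\<close>.\<close>

lemma hyperplane_form_unit_normal:
  fixes H :: "('k::field ^ 'n::finite) set"
  assumes "hyperplane H" "Q \<notin> H"
  shows "\<exists>c. c \<noteq> 0 \<and> hyperplane_form H = const_poly c * linear_form (unit_normal Q H)"
proof -
  obtain a where a: "a \<noteq> 0" "hyperplane_form H = linear_form a" "H = {v. a \<odot> v = 0}"
    using hyperplane_form_eq[OF assms(1)] .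
  note N = unit_normal[OF assms]
  have "a = (a \<odot> Q) *s unit_normal Q H"
  proof (rule scalar_product_eqI)
    fix v
    have "v - (unit_normal Q H \<odot> v) *s Q \<in> H"
      using N(1) by (subst N(2)) (simp add: scalar_product_simps)
    then have "a \<odot> (v - (unit_normal Q H \<odot> v) *s Q) = 0" using a(3) by blast
    then show "a \<odot> v = ((a \<odot> Q) *s unit_normal Q H) \<odot> v"
      by (simp add: scalar_product_simps mult.commute)
  qed
  moreover have "a \<odot> Q \<noteq> 0" using a(3) assms(2) by blast
  ultimately show ?thesis using a(2) linear_form_scale by metis
qed

lemma codim2_intersections_codim2:
  assumes "arrangement A" "P \<in> codim2_intersections A"
  shows "linear_subspace_codim 2 P"
  using assms inter_hyperplanes_codim2 by (auto simp: arrangement_def codim2_intersections_def)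

context
  fixes A :: "('k::field_char_0 ^ 'n::finite) set set" and Q :: "'k ^ 'n"
  assumes A: "arrangement A" and Q: "\<And>H. H \<in> A \<Longrightarrow> Q \<notin> H"
begin

lemma unit_normal_arrangement:
  assumes "H \<in> A"
  shows "unit_normal Q H \<odot> Q = 1" "H = {v. unit_normal Q H \<odot> v = 0}"
  using unit_normal[of H Q] assms A Q by (auto simp: arrangement_def)

lemma inj_unit_normal: "inj_on (unit_normal Q) A"
  by (rule inj_onI) (metis unit_normal_arrangement(2))

interpretation normalized_forms "unit_normal Q ` A" Q
  using A unit_normal_arrangement(1) by unfold_locales (auto simp: arrangement_def)

lemma arrangement_poly_eq:
  "\<exists>c. c \<noteq> 0 \<and> arrangement_poly A = const_poly c * prod linear_form (unit_normal Q ` A)"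
proof -
  have "\<forall>H\<in>A. \<exists>c. c \<noteq> 0 \<and> hyperplane_form H = const_poly c * linear_form (unit_normal Q H)"
    using hyperplane_form_unit_normal A Q unfolding arrangement_def by blast
  then obtain c where c: "\<forall>H\<in>A. c H \<noteq> 0 \<and> hyperplane_form H = const_poly (c H) * linear_form (unit_normal Q H)"
    by (rule bchoice[THEN exE])
  have fin: "finite A" using A by (simp add: arrangement_def)
  have "(\<Prod>H\<in>A. const_poly (c H)) = (const_poly (prod c A) :: ('k, 'n) polys)"
    using fin by induction (simp_all add: mult_single)
  moreover have "prod c A \<noteq> 0" using c fin by simp
  moreover have "arrangement_poly A = (\<Prod>H\<in>A. const_poly (c H)) * prod linear_form (unit_normal Q ` A)"
    using c by (simp add: arrangement_poly_def prod.reindex[OF inj_unit_normal] flip: prod.distrib)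
  ultimately show ?thesis by metis
qed

lemma pencil_unit_normal:
  assumes "H \<in> A" "b \<noteq> 0" "b \<odot> Q = 0"
  shows "card (pencil (unit_normal Q H) b) =
    num_containing A {v. b \<odot> v = 0 \<and> unit_normal Q H \<odot> v = 0}"
proof -
  have "pencil (unit_normal Q H) b =
      unit_normal Q ` {H' \<in> A. {v. b \<odot> v = 0 \<and> unit_normal Q H \<odot> v = 0} \<subseteq> H'}"
  proof -
    have "unit_normal Q H' \<in> pencil (unit_normal Q H) b \<longleftrightarrow>
        {v. b \<odot> v = 0 \<and> unit_normal Q H \<odot> v = 0} \<subseteq> H'" if "H' \<in> A" for H'
      using in_pencil_iff[of "unit_normal Q H" b "unit_normal Q H'"] that assms
        unit_normal_arrangement(2)[OF that] by blast
    then show ?thesis using pencil_subset[of "unit_normal Q H" b] by blast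
  qed
  then show ?thesis
    unfolding num_containing_def by (simp add: card_image inj_on_subset[OF inj_unit_normal])
qed

lemma component_ideal_unit_normal:
  assumes "H \<in> A" "b \<noteq> 0" "b \<odot> Q = 0"
  shows "component_ideal Q {v. b \<odot> v = 0 \<and> unit_normal Q H \<odot> v = 0} e =
    ideal_gen {linear_form b, linear_form (unit_normal Q H) ^ e}"
  using dual_basis_ex[of "unit_normal Q H" Q b] unit_normal_arrangement(1)[OF assms(1)] assms(2,3)
    component_ideal_eq by blast

text \<open>Translates \<open>residual_iff\<close> into geometry: the pairs of a member
  \<open>H\<close> and a form \<open>b\<close> correspond to subspaces of \<open>H\<close>, and
  those lying in no other member contribute only the unit ideal.\<close>

theorem residual_eq_residual_like_ideal:
  "residual A (linear_form Q) =
     residual_like_ideal (codim2_intersections A) (\<lambda>P. num_containing A P - 1) Q"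
proof -
  obtain c where c: "c \<noteq> 0" "arrangement_poly A = const_poly c * prod linear_form (unit_normal Q ` A)"
    using arrangement_poly_eq by blast
  have *: "g \<in> residual A (linear_form Q) \<longleftrightarrow>
    (\<forall>H\<in>A. \<forall>b. b \<noteq> 0 \<and> b \<odot> Q = 0 \<longrightarrow>
      g \<in> component_ideal Q {v. b \<odot> v = 0 \<and> unit_normal Q H \<odot> v = 0}
        (num_containing A {v. b \<odot> v = 0 \<and> unit_normal Q H \<odot> v = 0} - 1))" for g
    unfolding residual_def colon_Jac_iff[OF c(2,1)] residual_iff
    by (simp add: pencil_unit_normal component_ideal_unit_normal)
  show ?thesis
  proof (intro equalityI subsetI)
    fix g assume g: "g \<in> residual A (linear_form Q)"
    show "g \<in> residual_like_ideal (codim2_intersections A) (\<lambda>P. num_containing A P - 1) Q"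
      unfolding residual_like_ideal_eq
    proof
      fix P assume "P \<in> codim2_intersections A"
      then obtain H H' where H: "H \<in> A" "H' \<in> A" "H \<noteq> H'" "P = H \<inter> H'"
        by (auto simp: codim2_intersections_def)
      note N = unit_normal_arrangement[OF H(1)] and N' = unit_normal_arrangement[OF H(2)]
      \<comment> \<open>This form vanishes on \<open>P\<close> and at \<open>Q\<close>, so it is an
        equation of the hyperplane spanned by them.\<close>
      let ?b = "unit_normal Q H' - unit_normal Q H"
      have "?b \<noteq> 0" using inj_unit_normal H(1-3) by (auto dest: inj_onD)
      moreover have "?b \<odot> Q = 0" using N N' by (simp add: scalar_product_simps)
      moreover have "P = {v. ?b \<odot> v = 0 \<and> unit_normal Q H \<odot> v = 0}"
      proof -
        have "v \<in> P \<longleftrightarrow> unit_normal Q H \<odot> v = 0 \<and> unit_normal Q H' \<odot> v = 0" for v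
          using N(2) N'(2) H(4) by blast
        moreover have "?b \<odot> v = 0 \<longleftrightarrow> unit_normal Q H' \<odot> v = unit_normal Q H \<odot> v" for v
          by (simp add: scalar_product_diff_left)
        ultimately show ?thesis by (intro set_eqI) (simp only: mem_Collect_eq, argo)
      qed
      ultimately show "g \<in> component_ideal Q P (num_containing A P - 1)"
        using g[unfolded *] H(1) by simp
    qed
  next
    fix g assume g: "g \<in> residual_like_ideal (codim2_intersections A) (\<lambda>P. num_containing A P - 1) Q"
    show "g \<in> residual A (linear_form Q)"
      unfolding *
    proof (intro ballI allI impI)
      fix H b assume H: "H \<in> A" and b: "b \<noteq> 0 \<and> b \<odot> Q = 0"
      let ?P = "{v. b \<odot> v = 0 \<and> unit_normal Q H \<odot> v = 0}"
      note N = unit_normal_arrangement[OF H]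
      obtain x where x: "b \<odot> x = 1" "unit_normal Q H \<odot> x = 0"
        using dual_basis_ex[of "unit_normal Q H" Q b] N b by blast
      have PH: "?P \<subseteq> H" using N(2) by blast
      show "g \<in> component_ideal Q ?P (num_containing A ?P - 1)"
      proof (cases "\<exists>H'\<in>A. H' \<noteq> H \<and> ?P \<subseteq> H'")
        case True
        then obtain H' where H': "H' \<in> A" "H' \<noteq> H" "?P \<subseteq> H'" by blast
        have "linear_subspace_codim 2 ?P"
          by (rule codim2_zeros[of b x Q]) (use x b N in auto)
        moreover have "linear_subspace_codim 2 (H \<inter> H')"
          using A H H' by (intro inter_hyperplanes_codim2) (auto simp: arrangement_def)
        ultimately have "?P = H \<inter> H'"
          using PH H'(3) by (intro linear_subspace_codim_eqI) blast+
        then have "?P \<in> codim2_intersections A"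
          using H H' unfolding codim2_intersections_def by blast
        then show ?thesis using g unfolding residual_like_ideal_eq by blast
      next
        case False
        \<comment> \<open>Here the exponent is \<open>1 - 1 = 0\<close>, and the component contains
          1.\<close>
        then have "{H' \<in> A. ?P \<subseteq> H'} = {H}" using H PH by blast
        then have "num_containing A ?P - 1 = 0" by (simp add: num_containing_def)
        moreover have "g * 1 \<in> ideal_gen {linear_form b, 1}"
          by (rule ideal_gen_mult[OF ideal_gen_base]) simp
        ultimately show ?thesis
          using component_ideal_unit_normal[OF H, of b 0] b by simp
      qed
    qed
  qed
qed

end

text \<open>For \<open>Q\<close> on \<open>H\<close> the form of \<open>H\<close> divides both
  generators of the base ideal. It does not divide the derivative in a direction transversal to
  \<open>H\<close>, as the other factors are not multiples of it; being prime, it divides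
  \<open>g\<close>.\<close>

lemma residual_subset_dvd:
  fixes A :: "('k::field_char_0 ^ 'n::finite) set set"
  assumes A: "arrangement A" and H: "H \<in> A" "Q \<in> H"
    and g: "g \<in> residual A (linear_form Q)" and v: "v \<in> H"
  shows "poly_eval g v = 0"
proof -
  obtain a where a: "a \<noteq> 0" "hyperplane_form H = linear_form a" "H = {v. a \<odot> v = 0}"
    using hyperplane_form_eq A H(1) by (metis arrangement_def)
  let ?f = "arrangement_poly A" and ?F = "\<Prod>H'\<in>A - {H}. hyperplane_form H'"
  have f: "?f = linear_form a * ?F"
    using A H(1) by (simp add: arrangement_poly_def arrangement_def prod.remove a(2))
  have D: "dir_deriv u ?f = const_poly (a \<odot> u) * ?F + linear_form a * dir_deriv u ?F" for u
    by (simp add: f dir_deriv_mult)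
  have J: "linear_form a dvd h" if "h \<in> ideal_gen {?f, dir_deriv Q ?f}" for h
  proof -
    have "a \<odot> Q = 0" using a(3) H(2) by blast
    then have "linear_form a dvd dir_deriv Q ?f" by (simp add: D)
    moreover have "linear_form a dvd ?f" by (simp add: f)
    ultimately show ?thesis using that by (auto simp: in_ideal_gen_two)
  qed
  obtain u where u: "a \<odot> u = 1" using exists_scalar_product_1[OF a(1)] .
  have "g * dir_deriv u ?f \<in> ideal_gen {?f, dir_deriv Q ?f}"
    using g colon_Jac_iff[of ?f 1 ?f g Q] by (simp add: residual_def)
  then have "linear_form a dvd g * dir_deriv u ?f" by (rule J)
  moreover have "g * dir_deriv u ?f = g * ?F + linear_form a * (g * dir_deriv u ?F)"
    by (simp add: D u algebra_simps)
  ultimately have "linear_form a dvd g * ?F"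
    by (metis dvd_add_left_iff dvd_triv_left)
  moreover have "\<not> linear_form a dvd ?F"
  proof
    assume "linear_form a dvd ?F"
    then obtain H' where H': "H' \<in> A" "H' \<noteq> H" "linear_form a dvd hyperplane_form H'"
      using linear_form_dvd_prod[OF a(1), of "A - {H}" hyperplane_form] A by (auto simp: arrangement_def)
    obtain a' where a': "hyperplane_form H' = linear_form a'" "H' = {v. a' \<odot> v = 0}"
      using hyperplane_form_eq A H'(1) by (metis arrangement_def)
    have "H \<subseteq> H'"
      using H'(3) linear_form_dvd_iff[OF a(1)] a(3) a' by auto
    then show False
      using linear_subspace_codim_eqI A H(1) H'(1,2) by (metis arrangement_def)
  qed
  ultimately have "linear_form a dvd g" using linear_form_prime[OF a(1)] by blast
  then show ?thesis using linear_form_dvd_iff[OF a(1)] a(3) v by blast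
qed

subsection \<open>Counting in an arrangement\<close>

lemma finite_codim2_intersections: "finite A \<Longrightarrow> finite (codim2_intersections A)"
  by (rule finite_subset[of _ "(\<lambda>(H, H'). H \<inter> H') ` (A \<times> A)"])
    (auto simp: codim2_intersections_def)

lemma codim2_intersection_eq:
  fixes A :: "('k::field ^ 'n::finite) set set"
  assumes "linear_subspace_codim 2 P" "hyperplane H" "hyperplane H'" "H \<noteq> H'" "P \<subseteq> H" "P \<subseteq> H'"
  shows "P = H \<inter> H'"
  using assms inter_hyperplanes_codim2 by (intro linear_subspace_codim_eqI) auto

lemma span_two_codim2:
  fixes P P' :: "('k::field ^ 'n::finite) set"
  assumes "linear_subspace_codim 2 P" "linear_subspace_codim 2 P'" "P \<noteq> P'"
    and "hyperplane H" "P \<subseteq> H" "P' \<subseteq> H"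
  shows "H = vec.span (P \<union> P')"
proof -
  have sub: "vec.span (P \<union> P') \<subseteq> H"
    using assms by (intro vec.span_minimal) (auto simp: linear_subspace_codim_def)
  obtain x where x: "x \<in> P'" "x \<notin> P"
    using assms(1-3) linear_subspace_codim_eqI by blast
  have "vec.dim (insert x P) \<le> vec.dim (vec.span (P \<union> P'))"
    using x by (intro vec.dim_subset) (auto intro: vec.span_base)
  moreover have "vec.dim (insert x P) = vec.dim P + 1"
    using assms(1) x by (intro dim_insert_subspace) (auto simp: linear_subspace_codim_def)
  ultimately have "vec.dim H \<le> vec.dim (vec.span (P \<union> P'))"
    using assms(1,4) by (simp add: linear_subspace_codim_def)
  then have "vec.span (P \<union> P') = H"
    using sub assms(4) vec.subspace_span by (intro vec.subspace_dim_equal) (auto simp: linear_subspace_codim_def)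
  then show ?thesis ..
qed

context
  fixes A :: "('k::field ^ 'n::finite) set set"
  assumes A: "arrangement A"
begin

lemma finite_arrangement: "finite A" and hyperplane_arrangement: "H \<in> A \<Longrightarrow> hyperplane H"
  using A by (auto simp: arrangement_def)

lemma num_containing_ge_2:
  assumes "P \<in> codim2_intersections A"
  shows "num_containing A P \<ge> 2"
proof -
  obtain H H' where H: "H \<in> A" "H' \<in> A" "H \<noteq> H'" "P = H \<inter> H'"
    using assms by (auto simp: codim2_intersections_def)
  then have "card {H, H'} \<le> num_containing A P"
    unfolding num_containing_def using finite_arrangement by (intro card_mono) auto
  then show ?thesis using H(3) by simp
qed

lemma intersections_in_member:
  assumes "H \<in> A"
  shows "{P \<in> codim2_intersections A. P \<subseteq> H} = (\<lambda>H'. H \<inter> H') ` (A - {H})"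
proof (intro equalityI subsetI)
  fix P assume P: "P \<in> {P \<in> codim2_intersections A. P \<subseteq> H}"
  then obtain H1 H2 where "H1 \<in> A" "H2 \<in> A" "H1 \<noteq> H2" "P = H1 \<inter> H2"
    by (auto simp: codim2_intersections_def)
  then obtain H' where H': "H' \<in> A - {H}" "P \<subseteq> H'" by blast
  then have "P = H \<inter> H'"
    using P assms hyperplane_arrangement codim2_intersections_codim2[OF A]
    by (intro codim2_intersection_eq) auto
  then show "P \<in> (\<lambda>H'. H \<inter> H') ` (A - {H})" using H'(1) by blast
qed (use assms in \<open>auto simp: codim2_intersections_def\<close>)

text \<open>Sort the other members by their intersection with \<open>H\<close>: the fibre over
  \<open>P\<close> consists of the members through \<open>P\<close> except \<open>H\<close>.\<close>

lemma sum_intersections_in_member: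
  assumes H: "H \<in> A"
  shows "(\<Sum>P | P \<in> codim2_intersections A \<and> P \<subseteq> H. num_containing A P - 1) = card A - 1"
proof -
  have "card {H' \<in> A - {H}. H \<inter> H' = P} = num_containing A P - 1"
    if "P \<in> (\<lambda>H'. H \<inter> H') ` (A - {H})" for P
  proof -
    have P: "P \<in> codim2_intersections A" "P \<subseteq> H" using that intersections_in_member[OF H] by auto
    have "{H' \<in> A - {H}. H \<inter> H' = P} = {H' \<in> A. P \<subseteq> H'} - {H}"
      using codim2_intersection_eq[of P H] P H hyperplane_arrangement
        codim2_intersections_codim2[OF A P(1)] by auto
    then show ?thesis
      using H P(2) finite_arrangement by (simp add: num_containing_def)
  qed
  then have "(\<Sum>P\<in>(\<lambda>H'. H \<inter> H') ` (A - {H}). num_containing A P - 1) =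
      (\<Sum>P\<in>(\<lambda>H'. H \<inter> H') ` (A - {H}). card {H' \<in> A - {H}. H \<inter> H' = P})"
    by simp
  also have "\<dots> = card (A - {H})"
    using sum.image_gen[of "A - {H}" "\<lambda>_. 1 :: nat" "\<lambda>H'. H \<inter> H'"] finite_arrangement by simp
  finally show ?thesis
    using H finite_arrangement intersections_in_member[OF H] by simp
qed

text \<open>A member meets \<open>H\<close> in a single subspace of codimension two, so the sets of
  members through different \<open>P\<close> in \<open>H\<close> are disjoint.\<close>

lemma sum_intersections_in_nonmember:
  assumes H: "hyperplane H" "H \<notin> A"
  shows "(\<Sum>P | P \<in> codim2_intersections A \<and> P \<subseteq> H. num_containing A P) \<le> card A"
proof -
  let ?T = "{P \<in> codim2_intersections A. P \<subseteq> H}"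
  have "P = P'" if P: "P \<in> ?T" "P' \<in> ?T" "H' \<in> A" "P \<subseteq> H'" "P' \<subseteq> H'" for P P' H'
  proof -
    have H': "hyperplane H'" "H \<noteq> H'" using P(3) H(2) hyperplane_arrangement by blast+
    have "P'' = H \<inter> H'" if "P'' \<in> ?T" "P'' \<subseteq> H'" for P''
      using codim2_intersection_eq[OF _ H(1) H'] that codim2_intersections_codim2[OF A] by blast
    from this[of P] this[of P'] show ?thesis using P by simp
  qed
  then have "(\<Sum>P\<in>?T. card {H' \<in> A. P \<subseteq> H'}) = card (\<Union>P\<in>?T. {H' \<in> A. P \<subseteq> H'})"
    using finite_arrangement finite_codim2_intersections[OF finite_arrangement]
    by (intro card_UN_disjoint[symmetric]) auto
  also have "\<dots> \<le> card A"
    using finite_arrangement by (intro card_mono) auto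
  finally show ?thesis by (simp add: num_containing_def)
qed

text \<open>Otherwise all other members meet \<open>H\<close> in one and the same subspace; it then
  lies in every member and is the only intersection.\<close>

lemma members_contain_two_intersections:
  assumes "card (codim2_intersections A) \<ge> 2" "H \<in> A"
  shows "\<exists>P\<in>codim2_intersections A. \<exists>P'\<in>codim2_intersections A. P \<noteq> P' \<and> P \<subseteq> H \<and> P' \<subseteq> H"
proof (rule ccontr)
  assume neg: "\<not> ?thesis"
  obtain P0 where P0: "P0 \<in> codim2_intersections A"
    using assms(1) by (metis card.empty ex_in_conv not_numeral_le_zero)
  obtain H0 where H0: "H0 \<in> A" "H0 \<noteq> H"
    using P0 by (auto simp: codim2_intersections_def)
  have *: "H \<inter> H' = H \<inter> H0" if "H' \<in> A" "H' \<noteq> H" for H'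
  proof -
    have "H \<inter> H' \<in> codim2_intersections A" "H \<inter> H0 \<in> codim2_intersections A"
      using that H0 assms(2) unfolding codim2_intersections_def by blast+
    moreover have "H \<inter> H' \<subseteq> H" "H \<inter> H0 \<subseteq> H" by simp_all
    ultimately show ?thesis using neg by metis
  qed
  have sub: "H \<inter> H0 \<subseteq> H'" if "H' \<in> A" for H'
    using *[OF that] by blast
  have "P = H \<inter> H0" if P: "P \<in> codim2_intersections A" for P
  proof -
    obtain H1 H2 where H12: "H1 \<in> A" "H2 \<in> A" "H1 \<noteq> H2" "P = H1 \<inter> H2"
      using P by (auto simp: codim2_intersections_def)
    have "H \<inter> H0 = H1 \<inter> H2"
      using sub H12 hyperplane_arrangement H0 assms(2)
      by (intro codim2_intersection_eq inter_hyperplanes_codim2) auto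
    then show ?thesis using H12 by simp
  qed
  then have "codim2_intersections A \<subseteq> {H \<inter> H0}" by blast
  then have "card (codim2_intersections A) \<le> 1"
    using card_mono[of "{H \<inter> H0}"] by simp
  then show False using assms(1) by simp
qed

text \<open>Members have weight \<open>|A| - 1\<close>. A spanned nonmember contains at least two
  intersections, and lowering each \<open>t_P\<close> by 1 in a sum that is at most
  \<open>|A|\<close> leaves at most \<open>|A| - 2\<close>.\<close>

lemma arrangement_determined:
  assumes two: "card (codim2_intersections A) \<ge> 2"
    and E: "\<forall>P\<in>codim2_intersections A. E P = num_containing A P - 1"
  shows "dnum (codim2_intersections A) E = card A"
    and "max_hyperplanes (codim2_intersections A) E = A"
proof -
  let ?S = "codim2_intersections A"
  let ?L = "spanned_hyperplanes ?S"
  have finS: "finite ?S" using finite_arrangement by (rule finite_codim2_intersections)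
  have finL: "finite ?L"
    by (rule finite_subset[of _ "(\<lambda>(P, P'). vec.span (P \<union> P')) ` (?S \<times> ?S)"])
      (use finS in \<open>auto simp: spanned_hyperplanes_def\<close>)
  have weight: "weight_sum ?S E H = (\<Sum>P | P \<in> ?S \<and> P \<subseteq> H. num_containing A P - 1)" for H
    unfolding weight_sum_def using E by (intro sum.cong) auto
  have member: "weight_sum ?S E H = card A - 1" if "H \<in> A" for H
    unfolding weight by (rule sum_intersections_in_member[OF that])
  have AL: "A \<subseteq> ?L"
  proof
    fix H assume H: "H \<in> A"
    obtain P P' where P: "P \<in> ?S" "P' \<in> ?S" "P \<noteq> P'" "P \<subseteq> H" "P' \<subseteq> H"
      using members_contain_two_intersections[OF two H] by blast
    then have "H = vec.span (P \<union> P')"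
      using span_two_codim2 codim2_intersections_codim2[OF A] hyperplane_arrangement[OF H] by blast
    then show "H \<in> ?L"
      using P(1-3) hyperplane_arrangement[OF H] unfolding spanned_hyperplanes_def by blast
  qed
  have nonmember: "weight_sum ?S E H < card A - 1" if H: "H \<in> ?L" "H \<notin> A" for H
  proof -
    let ?T = "{P. P \<in> ?S \<and> P \<subseteq> H}"
    obtain P P' where P: "P \<in> ?S" "P' \<in> ?S" "P \<noteq> P'" "H = vec.span (P \<union> P')" "hyperplane H"
      using H(1) by (auto simp: spanned_hyperplanes_def)
    then have "{P, P'} \<subseteq> ?T" by (auto intro: vec.span_base)
    then have "card {P, P'} \<le> card ?T" using finS by (intro card_mono) auto
    then have "2 \<le> card ?T" using P(3) by simp
    \<comment> \<open>Natural subtraction is exact here because \<open>t_P \<ge> 2\<close>.\<close>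
    moreover have "(\<Sum>P\<in>?T. num_containing A P) = (\<Sum>P\<in>?T. (num_containing A P - 1) + 1)"
      using num_containing_ge_2 by (intro sum.cong) (auto dest!: num_containing_ge_2)
    then have "(\<Sum>P\<in>?T. num_containing A P) = weight_sum ?S E H + card ?T"
      by (simp only: sum.distrib weight) simp
    ultimately show ?thesis
      using sum_intersections_in_nonmember[OF P(5) H(2)] by simp
  qed
  have "?S \<noteq> {}" using two by auto
  then have "A \<noteq> {}" by (auto simp: codim2_intersections_def)
  then obtain H where H: "H \<in> A" by blast
  have "Max (weight_sum ?S E ` ?L) = card A - 1"
  proof (rule Max_eqI)
    show "card A - 1 \<in> weight_sum ?S E ` ?L" using member[OF H] AL H by force
    show "y \<le> card A - 1" if "y \<in> weight_sum ?S E ` ?L" for y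
      using that member nonmember by (force dest: less_imp_le)
  qed (use finL in simp)
  moreover have "card A > 0" using H finite_arrangement card_gt_0_iff by blast
  ultimately show d: "dnum ?S E = card A" using AL H by (auto simp: dnum_def)
  show "max_hyperplanes ?S E = A"
    unfolding max_hyperplanes_def d using AL member nonmember by fastforce
qed

end

section \<open>Arrangements of hyperplanes spanned by elements of \<open>Y\<close>\<close>

lemma finite_spanned_hyperplanes: "finite Y \<Longrightarrow> finite (spanned_hyperplanes Y)"
  by (rule finite_subset[of _ "(\<lambda>(P, P'). vec.span (P \<union> P')) ` (Y \<times> Y)"])
    (auto simp: spanned_hyperplanes_def)

lemma arrangement_subset_spanned_hyperplanes:
  "finite Y \<Longrightarrow> K \<subseteq> spanned_hyperplanes Y \<Longrightarrow> arrangement K"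
  using finite_subset[OF _ finite_spanned_hyperplanes]
  by (auto simp: arrangement_def spanned_hyperplanes_def)

lemma max_hyperplanes_subset: "max_hyperplanes Y E \<subseteq> spanned_hyperplanes Y"
  by (auto simp: max_hyperplanes_def)

text \<open>Each \<open>P\<close> in \<open>Y\<close> lies on at least two members, hence is an
  intersection. Conversely, for a member \<open>H\<close> the numbers \<open>t_P - 1\<close> have
  the same sum over all intersections in \<open>H\<close> as over those from \<open>Y\<close>, so an
  intersection outside \<open>Y\<close> would have \<open>t_P - 1 = 0\<close>.\<close>

lemma codim2_intersections_max_hyperplanes:
  fixes Y :: "('k::field ^ 'n::finite) set set"
  assumes Y: "finite Y" "\<And>P. P \<in> Y \<Longrightarrow> linear_subspace_codim 2 P" "\<And>P. P \<in> Y \<Longrightarrow> E P > 0"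
    and card: "card (max_hyperplanes Y E) = dnum Y E"
    and num: "\<And>P. P \<in> Y \<Longrightarrow> num_containing (max_hyperplanes Y E) P = E P + 1"
  shows "codim2_intersections (max_hyperplanes Y E) = Y"
proof
  let ?K = "max_hyperplanes Y E"
  have K: "arrangement ?K"
    using arrangement_subset_spanned_hyperplanes[OF Y(1) max_hyperplanes_subset] .
  have hyp: "hyperplane H" if "H \<in> ?K" for H using hyperplane_arrangement[OF K that] .
  show sub: "Y \<subseteq> codim2_intersections ?K"
  proof
    fix P assume P: "P \<in> Y"
    have "2 \<le> card {H \<in> ?K. P \<subseteq> H}"
      using num[OF P] Y(3)[OF P] by (simp add: num_containing_def)
    then obtain T where "T \<subseteq> {H \<in> ?K. P \<subseteq> H}" "card T = 2"
      by (rule obtain_subset_with_card_n)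
    then obtain H H' where H: "H \<in> ?K" "P \<subseteq> H" "H' \<in> ?K" "P \<subseteq> H'" "H \<noteq> H'"
      by (auto simp: card_2_iff)
    then have "P = H \<inter> H'" using codim2_intersection_eq[OF Y(2)[OF P]] hyp by blast
    then show "P \<in> codim2_intersections ?K" using H by (auto simp: codim2_intersections_def)
  qed
  show "codim2_intersections ?K \<subseteq> Y"
  proof
    fix P assume P: "P \<in> codim2_intersections ?K"
    then obtain H where H: "H \<in> ?K" "P \<subseteq> H" by (auto simp: codim2_intersections_def)
    let ?T = "{P \<in> codim2_intersections ?K. P \<subseteq> H}" and ?U = "{P \<in> Y. P \<subseteq> H}"
    let ?w = "\<lambda>P. num_containing ?K P - 1"
    have finT: "finite ?T"
      using finite_codim2_intersections[OF finite_arrangement[OF K]] by simp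
    have "sum ?w ?T = card ?K - 1"
      using sum_intersections_in_member[OF K H(1)] by simp
    also have "\<dots> = weight_sum Y E H"
      using H(1) card by (simp add: max_hyperplanes_def)
    also have "\<dots> = sum ?w ?U" using num by (simp add: weight_sum_def)
    finally have "sum ?w ?T = sum ?w ?U" .
    moreover have "sum ?w (?T - ?U) = sum ?w ?T - sum ?w ?U"
      using sub Y(1) by (intro sum_diff_nat) auto
    ultimately have "sum ?w (?T - ?U) = 0" by simp
    then have zero: "\<forall>P\<in>?T - ?U. ?w P = 0"
      by (subst (asm) sum_eq_0_iff) (use finT in simp_all)
    show "P \<in> Y"
    proof (rule ccontr)
      assume "P \<notin> Y"
      then have "?w P = 0" using P H(2) by (intro bspec[OF zero]) simp
      then show False using num_containing_ge_2[OF K P] by simp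
    qed
  qed
qed


subsection \<open>Zariski-open sets\<close>

lemma homogeneous_mult:
  fixes F G :: "('k::comm_ring_1, 'n::finite) polys"
  assumes "homogeneous F" "homogeneous G"
  shows "homogeneous (F * G)"
proof -
  obtain d e where
    d: "\<forall>m\<in>Poly_Mapping.keys F. (\<Sum>i\<in>UNIV. Poly_Mapping.lookup m i) = d" and
    e: "\<forall>m\<in>Poly_Mapping.keys G. (\<Sum>i\<in>UNIV. Poly_Mapping.lookup m i) = e"
    using assms by (auto simp: homogeneous_def)
  have "(\<Sum>i\<in>UNIV. Poly_Mapping.lookup m i) = d + e" if "m \<in> Poly_Mapping.keys (F * G)" for m
    using that keys_mult[of F G] d e by (fastforce simp: lookup_add sum.distrib)
  then show ?thesis unfolding homogeneous_def by blast
qed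

lemma zariski_open_Int:
  assumes "zariski_open U" "zariski_open V"
  shows "zariski_open (U \<inter> V)"
proof -
  obtain S T where "\<forall>F\<in>S. homogeneous F" "U = {v. v \<noteq> 0 \<and> (\<exists>F\<in>S. poly_eval F v \<noteq> 0)}"
    "\<forall>F\<in>T. homogeneous F" "V = {v. v \<noteq> 0 \<and> (\<exists>F\<in>T. poly_eval F v \<noteq> 0)}"
    using assms by (auto simp: zariski_open_def)
  then show ?thesis
    unfolding zariski_open_def
    by (intro exI[of _ "(\<lambda>(F, G). F * G) ` (S \<times> T)"]) (auto intro: homogeneous_mult)
qed

lemma zariski_open_Int_nonempty:
  fixes U V :: "('k::field_char_0 ^ 'n::finite) set"
  assumes "zariski_open U" "zariski_open V" "U \<noteq> {}" "V \<noteq> {}"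
  shows "U \<inter> V \<noteq> {}"
proof -
  obtain S T where U: "U = {v. v \<noteq> 0 \<and> (\<exists>F\<in>S. poly_eval F v \<noteq> 0)}"
    and V: "V = {v. v \<noteq> 0 \<and> (\<exists>F\<in>T. poly_eval F v \<noteq> 0)}"
    using assms(1,2) by (auto simp: zariski_open_def)
  obtain v F where v: "v \<noteq> 0" "F \<in> S" "poly_eval F v \<noteq> 0" using assms(3) U by blast
  obtain w G where w: "G \<in> T" "poly_eval G w \<noteq> 0" using assms(4) V by blast
  \<comment> \<open>A coordinate that is nonzero at \<open>v\<close> is multiplied in to keep the
    common point \<open>u\<close> away from the origin.\<close>
  obtain i where "v $ i \<noteq> 0" using v(1) by (auto simp: vec_eq_iff)
  then have "poly_eval (linear_form (axis i 1) * F) v \<noteq> 0"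
    using v(3) by (simp add: scalar_product_axis')
  then obtain u where u: "poly_eval (linear_form (axis i 1) * F * G) u \<noteq> 0"
    using subspace_nonvanishing_mult[OF vec.subspace_UNIV] w(2) by blast
  then have "u \<noteq> 0" by auto
  then show ?thesis using u v(2) w(1) U V by auto
qed

lemma zariski_open_nonzero: "zariski_open {v. v \<noteq> 0}"
proof -
  have "homogeneous (1 :: ('a, 'b) polys)" by (simp add: homogeneous_def)
  then show ?thesis unfolding zariski_open_def by (intro exI[of _ "{1}"]) simp
qed

lemma zariski_open_Inter_ex:
  fixes \<U> :: "('k::field_char_0 ^ 'n::finite) set set"
  assumes "finite \<U>" "\<And>U. U \<in> \<U> \<Longrightarrow> zariski_open U \<and> U \<noteq> {}"
  shows "\<exists>V. zariski_open V \<and> V \<noteq> {} \<and> (\<forall>U\<in>\<U>. V \<subseteq> U)"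
  using assms
proof (induction \<U>)
  case empty
  have "axis undefined 1 \<noteq> (0 :: 'k ^ 'n)" by (simp add: axis_eq_0_iff)
  then have "{v :: 'k ^ 'n. v \<noteq> 0} \<noteq> {}" by blast
  then show ?case using zariski_open_nonzero by blast
next
  case (insert U \<U>)
  then obtain V where "zariski_open V" "V \<noteq> {}" "\<forall>U\<in>\<U>. V \<subseteq> U" by auto
  then show ?case
    using insert.prems[of U] zariski_open_Int[of U V] zariski_open_Int_nonempty[of U V]
    by (intro exI[of _ "U \<inter> V"]) auto
qed

text \<open>A subspace is cut out by the linear forms that vanish on it.\<close>

lemma zariski_open_Compl_subspace:
  fixes W :: "('k::field ^ 'n::finite) set"
  assumes "vec.subspace W"
  shows "zariski_open (- W)"
proof -
  have "- W = {v. v \<noteq> 0 \<and> (\<exists>a. (\<forall>w\<in>W. a \<odot> w = 0) \<and> a \<odot> v \<noteq> 0)}"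
    using functional_ex[OF assms] vec.subspace_0[OF assms] by fastforce
  then show ?thesis
    unfolding zariski_open_def
    by (intro exI[of _ "linear_form ` {a. \<forall>w\<in>W. a \<odot> w = 0}"])
      (auto simp: homogeneous_linear_form)
qed

lemma Compl_linear_subspace_codim:
  fixes W :: "('k::field ^ 'n::finite) set"
  assumes "linear_subspace_codim c W" "c > 0"
  shows "zariski_open (- W) \<and> - W \<noteq> {}"
proof -
  have "W \<noteq> UNIV"
    using assms by (auto simp: linear_subspace_codim_def vec.dimension_def card_cart_basis)
  then show ?thesis
    using assms zariski_open_Compl_subspace by (auto simp: linear_subspace_codim_def)
qed

section \<open>The equivalence for a general point\<close>

theorem proposition6p3:
  fixes Y :: "('k::field_char_0 ^ 'n::finite) set set"
    and G :: "('k ^ 'n) set set \<Rightarrow> ('k ^ 'n) set"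
    and n :: nat
  assumes "n \<ge> 2" and "CARD('n) = n + 1"
    and "finite Y" and "card Y \<ge> 2" and "\<forall>P\<in>Y. linear_subspace_codim 2 P"
    and "\<forall>A. arrangement A \<longrightarrow> zariski_open (G A) \<and> G A \<noteq> {}"
  shows "\<exists>U. zariski_open U \<and> U \<noteq> {} \<and>
    (\<forall>Q\<in>U. \<forall>E. (\<forall>P\<in>Y. E P > 0) \<longrightarrow>
      (let I = residual_like_ideal Y E Q;
           d = dnum Y E;
           K = max_hyperplanes Y E;
           cond_i = (\<exists>A. general_residual G I A (linear_form Q));
           cond_ii = (card K = d \<and> (\<forall>P\<in>Y. num_containing K P = E P + 1))
       in (cond_i \<longleftrightarrow> cond_ii) \<and>
          (cond_i \<longrightarrow>
             general_residual G I K (linear_form Q) \<and>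
             Y = codim2_intersections K \<and>
             (\<forall>P\<in>Y. num_containing K P = E P + 1))))"
proof -
  have Y: "\<And>P. P \<in> Y \<Longrightarrow> linear_subspace_codim 2 P" using assms(5) by blast
  define L where "L = spanned_hyperplanes Y"
  have finL: "finite L" unfolding L_def using assms(3) by (rule finite_spanned_hyperplanes)
  have arr: "arrangement K" if "K \<subseteq> L" for K
    using arrangement_subset_spanned_hyperplanes[OF assms(3)] that unfolding L_def .
  \<comment> \<open>Finitely many conditions on \<open>Q\<close> that do not involve
    \<open>E\<close>: whatever \<open>E\<close> is, the set \<open>\<K>\<close> is one of the
    subsets of \<open>L\<close>, so generality for all of these covers it.\<close>
  define \<U> where "\<U> = uminus ` Y \<union> uminus ` L \<union> G ` Pow L"
  have "finite \<U>" unfolding \<U>_def using assms(3) finL by simp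
  moreover have "zariski_open U \<and> U \<noteq> {}" if "U \<in> \<U>" for U
  proof -
    have "zariski_open (- P) \<and> - P \<noteq> {}" if "P \<in> Y" for P
      using Compl_linear_subspace_codim[OF Y[OF that]] by simp
    moreover have "zariski_open (- H) \<and> - H \<noteq> {}" if "H \<in> L" for H
    proof (rule Compl_linear_subspace_codim)
      show "hyperplane H" using that unfolding L_def spanned_hyperplanes_def by blast
    qed simp
    moreover have "zariski_open (G K) \<and> G K \<noteq> {}" if "K \<in> Pow L" for K
      using assms(6) arr that by blast
    ultimately show ?thesis
      using that unfolding \<U>_def by (elim UnE imageE) (simp_all only: simp_thms)
  qed
  ultimately obtain U where U: "zariski_open U" "U \<noteq> {}" "\<forall>V\<in>\<U>. U \<subseteq> V"
    using zariski_open_Inter_ex[of \<U>] by metis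
  have QY: "Q \<notin> P" if "Q \<in> U" "P \<in> Y" for Q P
  proof -
    have "- P \<in> \<U>" using that(2) by (simp add: \<U>_def)
    then show ?thesis using U(3) that(1) by blast
  qed
  have QL: "Q \<notin> H" if "Q \<in> U" "H \<in> L" for Q H
  proof -
    have "- H \<in> \<U>" using that(2) by (simp add: \<U>_def)
    then show ?thesis using U(3) that(1) by blast
  qed
  have QG: "Q \<in> G K" if "Q \<in> U" "K \<subseteq> L" for Q K
  proof -
    have "G K \<in> \<U>" using that(2) by (simp add: \<U>_def)
    then show ?thesis using U(3) that(1) by blast
  qed
  have i_imp: "max_hyperplanes Y E = A \<and> card A = dnum Y E \<and> Y = codim2_intersections A \<and>
      (\<forall>P\<in>Y. num_containing A P = E P + 1)"
    if Q: "Q \<in> U" and E: "\<forall>P\<in>Y. E P > 0"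
      and gen: "general_residual G (residual_like_ideal Y E Q) A (linear_form Q)" for Q E A
  proof -
    have A: "arrangement A" and I: "residual_like_ideal Y E Q = residual A (linear_form Q)"
      using gen unfolding general_residual_def by blast+
    \<comment> \<open>The witness \<open>A\<close> of (i) need not lie in \<open>L\<close>, so the
      choice of \<open>U\<close> does not settle this. If \<open>Q\<close> were on \<open>H\<close>,
      the residual would vanish on \<open>H\<close>, whereas \<open>I(Y, E)\<close> does not because
      no \<open>P\<close> contains \<open>H\<close>.\<close>
    have QA: "Q \<notin> H" if H: "H \<in> A" for H
    proof
      assume "Q \<in> H"
      note hyp = hyperplane_arrangement[OF A H]
      have "\<exists>h\<in>residual_like_ideal Y E Q. \<exists>v\<in>H. poly_eval h v \<noteq> 0"
      proof (rule residual_like_ideal_nonvanishing[OF assms(3)])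
        show "linear_subspace_codim 2 P \<and> Q \<notin> P \<and> \<not> H \<subseteq> P" if "P \<in> Y" for P
          using Y[OF that] QY[OF Q that] linear_subspace_codim_not_subset[OF hyp Y[OF that]] by simp
        show "vec.subspace H" using hyp by (simp add: linear_subspace_codim_def)
      qed
      then show False
        using residual_subset_dvd[OF A H \<open>Q \<in> H\<close>] unfolding I by blast
    qed
    let ?e = "\<lambda>P. num_containing A P - 1"
    have "Y = codim2_intersections A \<and> (\<forall>P\<in>Y. E P = ?e P)"
    proof (rule residual_like_ideal_inject[OF assms(3) _ finite_codim2_intersections[OF finite_arrangement[OF A]]])
      show "linear_subspace_codim 2 P \<and> Q \<notin> P \<and> 0 < E P" if "P \<in> Y" for P
        using that Y QY[OF Q] E by blast
      show "linear_subspace_codim 2 P \<and> Q \<notin> P \<and> 0 < ?e P" if P: "P \<in> codim2_intersections A" for P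
        using codim2_intersections_codim2[OF A P] num_containing_ge_2[OF A P] QA P
        by (auto simp: codim2_intersections_def)
      show "residual_like_ideal Y E Q = residual_like_ideal (codim2_intersections A) ?e Q"
        unfolding I by (rule residual_eq_residual_like_ideal[OF A QA])
    qed
    then have YA: "Y = codim2_intersections A" and EA: "\<forall>P\<in>codim2_intersections A. E P = ?e P"
      by auto
    have "\<forall>P\<in>Y. num_containing A P = E P + 1"
      using EA num_containing_ge_2[OF A] unfolding YA by fastforce
    then show ?thesis
      using arrangement_determined[OF A _ EA] assms(4) YA by simp
  qed
  \<comment> \<open>Under (ii) the arrangement \<open>\<K>\<close> is itself the witness: its
    intersections are \<open>Y\<close> with the right exponents, and \<open>Q\<close> is general for
    it as \<open>\<K>\<close> is contained in \<open>L\<close>.\<close>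
  have ii_imp: "general_residual G (residual_like_ideal Y E Q) (max_hyperplanes Y E) (linear_form Q)"
    if Q: "Q \<in> U" and E: "\<forall>P\<in>Y. E P > 0" and card: "card (max_hyperplanes Y E) = dnum Y E"
      and num: "\<forall>P\<in>Y. num_containing (max_hyperplanes Y E) P = E P + 1" for Q E
  proof -
    let ?K = "max_hyperplanes Y E"
    have KL: "?K \<subseteq> L" unfolding L_def by (rule max_hyperplanes_subset)
    have "residual ?K (linear_form Q) =
        residual_like_ideal (codim2_intersections ?K) (\<lambda>P. num_containing ?K P - 1) Q"
      using KL QL[OF Q] by (intro residual_eq_residual_like_ideal[OF arr[OF KL]]) blast
    also have "codim2_intersections ?K = Y"
      using codim2_intersections_max_hyperplanes[OF assms(3)] Y E card num by blast
    also have "residual_like_ideal Y (\<lambda>P. num_containing ?K P - 1) Q = residual_like_ideal Y E Q"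
      using num by (simp add: residual_like_ideal_eq)
    finally show ?thesis
      using arr[OF KL] QG[OF Q KL] by (simp add: general_residual_def)
  qed
  show ?thesis
    unfolding Let_def
  proof (intro exI[of _ U] conjI ballI allI impI iffI U(1,2))
    fix Q and E :: "('k ^ 'n) set \<Rightarrow> nat"
    assume Q: "Q \<in> U" and E: "\<forall>P\<in>Y. E P > 0"
    let ?I = "residual_like_ideal Y E Q" and ?K = "max_hyperplanes Y E"
    {
      assume "\<exists>A. general_residual G ?I A (linear_form Q)"
      then obtain A where A: "general_residual G ?I A (linear_form Q)" ..
      note * = i_imp[OF Q E A]
      show "card ?K = dnum Y E" "Y = codim2_intersections ?K"
        "general_residual G ?I ?K (linear_form Q)"
        using * A by auto
      show "num_containing ?K P = E P + 1" "num_containing ?K P = E P + 1" if "P \<in> Y" for P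
        using * that by auto
    }
    assume "card ?K = dnum Y E \<and> (\<forall>P\<in>Y. num_containing ?K P = E P + 1)"
    then show "\<exists>A. general_residual G ?I A (linear_form Q)"
      using ii_imp[OF Q E] by blast
  qed
qed

end
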